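(* The only integers that are both Fibonacci numbers (terms of $U_n(1,-1)$, $n\ge0$) and Pell numbers (terms of $U_n(2,-1)$, $n\ge0$) are $0,1,2,5$; i.e. $\{U_n(1,-1):n\ge0\}\cap\{U_n(2,-1):n\ge0\}=\{0,1,2,5\}$.
   Context: For integers $P,Q$, the Lucas sequence $U_n(P,Q)$ is defined by $U_0=0$, $U_1=1$, $U_{n+1}=P\,U_n-Q\,U_{n-1}$ for $n\ge1$. Thus $U_n(1,-1)$ are the Fibonacci numbers $0,1,1,2,3,5,8,\dots$ and $U_n(2,-1)$ are the Pell numbers $0,1,2,5,12,29,\dots$. *)

theory Defs
  imports Main
begin

fun lucasU :: "int \<Rightarrow> int \<Rightarrow> nat \<Rightarrow> int" where
  "lucasU P Q 0 = 0"
| "lucasU P Q (Suc 0) = 1"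
| "lucasU P Q (Suc (Suc n)) = P * lucasU P Q (Suc n) - Q * lucasU P Q n"

end

theory Submission
  imports Defs "HOL-Number_Theory.Number_Theory" "HOL-Computational_Algebra.Nth_Powers"
begin

text \<open>
  Let \<open>x\<close> be the \<open>m\<close>-th Fibonacci and the \<open>n\<close>-th Pell number. The companion sequences give
  \<open>y\<^sup>2 = 5x\<^sup>2 \<plusminus> 4\<close> and \<open>z\<^sup>2 = 2x\<^sup>2 \<plusminus> 1\<close>, the signs being those of \<open>(-1)\<^sup>m\<close> and \<open>(-1)\<^sup>n\<close>.
  Eliminating \<open>x\<close> leaves a norm equation in \<open>\<int>[\<surd>10]\<close>.

  If both indices are even, the norm equation leads to \<open>e(e + 1) = 40a\<^sup>4\<close>, which infinite descent
  excludes. If exactly one index is even, \<open>x\<^sup>2\<close> is a binary quadratic form in a solution \<open>(p, q)\<close> of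
  \<open>p\<^sup>2 - 10q\<^sup>2 = 1\<close>. Unless \<open>q = 0\<close>, the integer \<open>p\<close> has a divisor \<open>v = T(2\<^sup>s)\<close>, where \<open>T(k)\<close> is
  the rational part of \<open>(19 + 6\<surd>10)\<^sup>k\<close>. Modulo \<open>v\<close> the form makes a fixed negative number a square,
  against its Jacobi symbol.

  If both indices are odd, the \<open>\<surd>10\<close>-part of a unit of norm \<open>-1\<close> turns out to be a square, so modulo
  \<open>112\<close> its exponent is \<open>\<plusminus>1\<close> modulo \<open>16\<close>. This fixes either \<open>y\<close> modulo \<open>21\<close>, whence
  \<open>m \<equiv> \<plusminus>1 (mod 16)\<close>, or \<open>z\<close> modulo \<open>304\<close>, whence \<open>n \<equiv> \<plusminus>3 (mod 40)\<close>. In these classes Cohn's argument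
  (shifting the index by an odd multiple of \<open>2b\<close> changes the sign of the companion sequence modulo its
  \<open>b\<close>-th term) and a Jacobi symbol leave only \<open>m = 1\<close> and \<open>n = 3\<close>.
\<close>

section \<open>The Jacobi symbol\<close>

definition jacobi :: "int \<Rightarrow> nat \<Rightarrow> int" where
  "jacobi a n = (\<Prod>p\<in>#prime_factorization n. Legendre a (int p))"

lemma Legendre_values: "Legendre a p \<in> {-1, 0, 1}"
  by (simp add: Legendre_def)

lemma cong_small_values:
  fixes x y :: int
  assumes "x \<in> {-1, 0, 1}" "y \<in> {-1, 0, 1}" "[x = y] (mod p)" "p > 2"
  shows "x = y"
proof -
  have "p dvd x - y" using assms(3) by (simp add: cong_iff_dvd_diff)
  moreover have "\<bar>x - y\<bar> < p" using assms by auto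
  ultimately show ?thesis using dvd_imp_le_int[of "x - y" p] by fastforce
qed

text \<open>Euler's criterion with the base already reduced, so that for a numeral \<open>p\<close>
  and a known residue of \<open>a\<close> the last premise is a computation.\<close>

lemma Legendre_eqI:
  assumes "prime p" "2 < p" "e \<in> {-1, 0, 1}"
    and "(a mod int p) ^ ((p - 1) div 2) mod int p = e mod int p"
  shows "Legendre a (int p) = e"
proof -
  have "[Legendre a (int p) = a ^ ((p - 1) div 2)] (mod int p)"
    using euler_criterion assms by blast
  moreover have "[a ^ ((p - 1) div 2) = e] (mod int p)"
    using assms(4) by (simp only: cong_def power_mod)
  ultimately have "[Legendre a (int p) = e] (mod int p)" by (rule cong_trans)
  then show ?thesis using cong_small_values[OF Legendre_values assms(3)] assms(2) by simp
qed

lemma Legendre_mult: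
  assumes "prime p" "2 < p"
  shows "Legendre (a * b) (int p) = Legendre a (int p) * Legendre b (int p)"
proof -
  have "[a ^ ((p - 1) div 2) * b ^ ((p - 1) div 2) = Legendre a (int p) * Legendre b (int p)] (mod int p)"
    using euler_criterion[OF assms] by (intro cong_mult) (auto intro: cong_sym)
  moreover have "[Legendre (a * b) (int p) = a ^ ((p - 1) div 2) * b ^ ((p - 1) div 2)] (mod int p)"
    using euler_criterion[OF assms, of "a * b"] by (simp add: power_mult_distrib)
  ultimately have "[Legendre (a * b) (int p) = Legendre a (int p) * Legendre b (int p)] (mod int p)"
    by (metis cong_trans)
  moreover have "Legendre a (int p) * Legendre b (int p) \<in> {-1, 0, 1}"
    using Legendre_values[of a "int p"] Legendre_values[of b "int p"] by auto
  ultimately show ?thesis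
    using cong_small_values[OF Legendre_values] assms(2) by simp
qed

lemma jacobi_1 [simp]: "jacobi a (Suc 0) = 1"
  by (simp add: jacobi_def)

lemma jacobi_prime_times:
  assumes "prime p" "n > 0"
  shows "jacobi a (p * n) = Legendre a (int p) * jacobi a n"
  using assms by (simp add: jacobi_def prime_factorization_mult prime_factorization_prime)

lemma odd_prime_induct [consumes 1, case_names one factor]:
  fixes n :: nat
  assumes "odd n" "P (Suc 0)"
    and "\<And>p n. prime p \<Longrightarrow> 2 < p \<Longrightarrow> odd n \<Longrightarrow> P n \<Longrightarrow> P (p * n)"
  shows "P n"
  using assms(1)
proof (induction n rule: prime_divisors_induct)
  case (unit x)
  then show ?case using assms(2) by simp
next
  case (factor p x)
  then have "odd p" "odd x" by auto
  with factor have "2 < p" by (metis prime_ge_2_nat even_numeral le_neq_implies_less)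
  with factor \<open>odd x\<close> show ?case using assms(3) by blast
qed simp

lemma jacobi_mult:
  assumes "odd n"
  shows "jacobi (a * b) n = jacobi a n * jacobi b n"
  using assms
  by (induction n rule: odd_prime_induct)
    (auto simp: jacobi_prime_times Legendre_mult odd_pos)

lemma jacobi_minus_1:
  assumes "odd n"
  shows "jacobi (-1) n = (if n mod 4 = 1 then 1 else -1)"
  using assms
proof (induction n rule: odd_prime_induct)
  case (factor p n)
  then have "odd p" using prime_odd_nat by blast
  have L: "Legendre (-1) (int p) = (if p mod 4 = 1 then 1 else -1)"
  proof -
    have "[Legendre (-1) (int p) = (-1) ^ ((p - 1) div 2)] (mod int p)"
      using euler_criterion factor by blast
    moreover have "even ((p - 1) div 2) \<longleftrightarrow> p mod 4 = 1"
      using \<open>odd p\<close> by presburger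
    ultimately have c: "[Legendre (-1) (int p) = (if p mod 4 = 1 then 1 else -1)] (mod int p)"
      by (simp only: minus_one_power_iff)
    show ?thesis
      by (rule cong_small_values[OF Legendre_values _ c]) (use factor in simp_all)
  qed
  have "p mod 4 = 1 \<or> p mod 4 = 3" "n mod 4 = 1 \<or> n mod 4 = 3"
    using \<open>odd p\<close> factor(3) by presburger+
  moreover have "(p * n) mod 4 = ((p mod 4) * (n mod 4)) mod 4"
    by (simp only: mod_mult_eq)
  ultimately have "(p * n) mod 4 = 1 \<longleftrightarrow> (p mod 4 = 1 \<longleftrightarrow> n mod 4 = 1)"
    by (elim disjE) simp_all
  moreover have "jacobi (-1) (p * n) = Legendre (-1) (int p) * jacobi (-1) n"
    using jacobi_prime_times factor odd_pos by blast
  ultimately show ?case using factor.IH L by simp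
qed simp

text \<open>By Euler's criterion the symbol of the sign modulo \<open>p\<close> is exactly the sign
  in quadratic reciprocity, so the symbol of \<open>q\<close> modulo \<open>p\<close> occurs twice
  and cancels. For \<open>p = q\<close> both sides vanish.\<close>

lemma Legendre_prime_star:
  assumes p: "prime p" "2 < p" and q: "prime q" "2 < q"
  shows "Legendre ((-1) ^ ((q - 1) div 2) * int q) (int p) = Legendre (int p) (int q)"
proof (cases "p = q")
  case True
  then show ?thesis by (simp add: Legendre_def cong_0_iff)
next
  case False
  have odd: "odd p" "odd q" using p q prime_odd_nat by blast+
  let ?e = "(-1::int) ^ ((q - 1) div 2)"
  have c: "[Legendre ?e (int p) = ?e ^ ((p - 1) div 2)] (mod int p)"
    using euler_criterion p by blast
  have "?e ^ ((p - 1) div 2) \<in> {-1, 0, 1}"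
    by (cases "even ((q - 1) div 2)"; cases "even ((p - 1) div 2)") simp_all
  from cong_small_values[OF Legendre_values this c]
  have "Legendre ?e (int p) = ?e ^ ((p - 1) div 2)" using p by simp
  also have "\<dots> = (-1) ^ ((p - 1) div 2 * ((q - 1) div 2))"
    by (metis power_mult mult.commute)
  also have "\<dots> = Legendre (int p) (int q) * Legendre (int q) (int p)"
    by (rule Quadratic_Reciprocity[OF p q False, symmetric])
  finally have "Legendre (?e * int q) (int p)
      = Legendre (int p) (int q) * (Legendre (int q) (int p) * Legendre (int q) (int p))"
    by (simp only: Legendre_mult[OF p] mult.assoc)
  moreover have "\<not> p dvd q"
    using False p q primes_dvd_imp_eq by blast
  then have "Legendre (int q) (int p) \<in> {-1, 1}"
    by (simp add: Legendre_def cong_0_iff)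
  then have "Legendre (int q) (int p) * Legendre (int q) (int p) = 1" by auto
  ultimately show ?thesis by simp
qed

text \<open>The sign \<open>(-1) ^ ((q - 1) div 2)\<close> absorbs the sign of quadratic reciprocity, so no case distinction
  modulo 4 is needed.\<close>

lemma jacobi_prime_star:
  assumes "prime q" "2 < q" "odd n"
  shows "jacobi ((-1) ^ ((q - 1) div 2) * int q) n = Legendre (int n) (int q)"
  using assms(3)
proof (induction n rule: odd_prime_induct)
  case one
  show ?case
    using Legendre_eqI[OF assms(1,2), of 1 1] assms(2) by simp
next
  case (factor p n)
  then show ?case
    using Legendre_prime_star[OF factor(1,2) assms(1,2)] Legendre_mult[OF assms(1,2), of "int p" "int n"]
    factor.IH
    by (simp only: jacobi_prime_times[OF factor(1) odd_pos[OF factor(3)]] of_nat_mult)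
qed

section \<open>Squares modulo n and the sign of the symbol\<close>

text \<open>A square modulo \<open>n\<close> is a square modulo every prime factor. Common factors
  of \<open>a\<close> and \<open>n\<close> may make the symbol 0, but nonnegativity already
  contradicts a computed value -1.\<close>

lemma jacobi_nonneg_if_square:
  assumes "int n dvd x\<^sup>2 - a"
  shows "jacobi a n \<ge> 0"
proof -
  have "Legendre a (int p) \<ge> 0" if "p \<in># prime_factorization n" for p
  proof -
    have "int p dvd x\<^sup>2 - a"
      using that assms by (metis dvd_trans in_prime_factors_imp_dvd int_dvd_int_iff)
    then have "QuadRes (int p) a"
      by (auto simp: QuadRes_def cong_iff_dvd_diff)
    then show ?thesis by (simp add: Legendre_def)
  qed
  moreover have "(\<Prod>p\<in>#M. f p) \<ge> 0" if "\<forall>p\<in>#M. f p \<ge> 0" for f :: "nat \<Rightarrow> int" and M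
    using that by (induction M) simp_all
  ultimately show ?thesis by (simp add: jacobi_def)
qed

lemma jacobi_eq_1_if_square:
  assumes "int n dvd x\<^sup>2 - a" "coprime a (int n)"
  shows "jacobi a n = 1"
proof -
  have "Legendre a (int p) = 1" if "p \<in># prime_factorization n" for p
  proof -
    have *: "int p dvd int n" "prime (int p)"
      using that by auto
    then have "int p dvd x\<^sup>2 - a" using assms(1) dvd_trans by blast
    then have "QuadRes (int p) a"
      by (auto simp: QuadRes_def cong_iff_dvd_diff)
    moreover have "\<not> int p dvd a"
      using * assms(2) by (meson coprime_common_divisor not_prime_unit)
    ultimately show ?thesis by (simp add: Legendre_def cong_0_iff)
  qed
  then show ?thesis unfolding jacobi_def by (intro prod_mset.neutral) auto
qed

section \<open>Lucas sequences and their companions\<close>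

text \<open>With \<alpha> + 1/\<alpha> = c this is \<alpha>^n + \<alpha>^(-n). It is used for c = 3
  (Lucas numbers of even index), c = 6 (companion Pell numbers of even index) and c = 38 (twice the
  rational part of (19 + 6\<surd>10)^n).\<close>

fun lucasV :: "int \<Rightarrow> nat \<Rightarrow> int" where
  "lucasV c 0 = 2"
| "lucasV c (Suc 0) = c"
| "lucasV c (Suc (Suc n)) = c * lucasV c (Suc n) - lucasV c n"

text \<open>Expand (\<alpha>^(d+b) + \<alpha>^(-d-b)) (\<alpha>^b + \<alpha>^(-b)); counting from
  \<open>d\<close> keeps all indices natural.\<close>

lemma lucasV_add: "lucasV c (d + 2 * b) + lucasV c d = lucasV c (d + b) * lucasV c b"
proof (induction c b arbitrary: d rule: lucasV.induct)
  case (3 c b)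
  let ?V = "lucasV c"
  have "?V (d + 2 * Suc (Suc b)) = c * ?V (Suc d + 2 * Suc b) - ?V (Suc (Suc d) + 2 * b)"
    by simp
  moreover have "c * ?V (Suc d) - ?V (Suc (Suc d)) = ?V d" by simp
  moreover have "?V (d + Suc (Suc b)) * ?V (Suc (Suc b))
      = c * (?V (Suc d + Suc b) * ?V (Suc b)) - ?V (Suc (Suc d) + b) * ?V b"
    by (simp add: algebra_simps del: lucasV.simps(3) flip: lucasV.simps(3)) (simp add: algebra_simps)
  ultimately show ?case
    unfolding "3.IH"(1)[of "Suc d", symmetric] "3.IH"(2)[of "Suc (Suc d)", symmetric]
    by (simp add: right_diff_distrib distrib_left del: lucasV.simps)
qed simp_all

lemma lucasV_double: "lucasV c (2 * k) = (lucasV c k)\<^sup>2 - 2"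
  using lucasV_add[of c 0 k] by (simp add: power2_eq_square)

lemma lucasV_dvd_odd_multiple:
  assumes "odd g"
  shows "lucasV c b dvd lucasV c (b * g)"
proof -
  have "lucasV c b dvd lucasV c (b * (2 * j + 1))" for j
  proof (induction j)
    case (Suc j)
    have "lucasV c (b * (2 * Suc j + 1)) + lucasV c (b * (2 * j + 1)) = lucasV c (b * (2 * j + 1) + b) * lucasV c b"
      using lucasV_add[of c "b * (2 * j + 1)" b] by (simp add: algebra_simps)
    then show ?case using Suc by (metis dvd_add_left_iff dvd_triv_right)
  qed simp
  with assms show ?thesis by (metis oddE)
qed

text \<open>By \<open>lucasV_add\<close>, a shift by \<open>2 * b * g\<close> changes the sign
  modulo the term at \<open>b * g\<close>, which the term at \<open>b\<close> divides. The second
  claim is the shift of -a, as \<alpha>^n + \<alpha>^(-n) is even in n; \<open>a \<le> b * g\<close>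
  makes the subtractions genuine.\<close>

lemma lucasV_dvd_shift:
  assumes "odd g"
  shows "lucasV c b dvd lucasV c (2 * b * g + a) + lucasV c a"
    and "a \<le> b * g \<Longrightarrow> lucasV c b dvd lucasV c (2 * b * g - a) + lucasV c a"
proof -
  note dvd = lucasV_dvd_odd_multiple[OF assms, of c b]
  have "lucasV c (2 * b * g + a) + lucasV c a = lucasV c (a + b * g) * lucasV c (b * g)"
    using lucasV_add[of c a "b * g"] by (simp add: algebra_simps)
  then show "lucasV c b dvd lucasV c (2 * b * g + a) + lucasV c a" using dvd by simp
  assume "a \<le> b * g"
  then obtain d where d: "b * g = a + d" using le_Suc_ex by blast
  have "2 * b * g - a = a + 2 * d" using d by simp
  then have "lucasV c (2 * b * g - a) + lucasV c a = lucasV c (b * g) * lucasV c d"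
    using lucasV_add[of c a d] d by simp
  then show "lucasV c b dvd lucasV c (2 * b * g - a) + lucasV c a" using dvd by simp
qed

lemma lucasU_Cassini:
  "(lucasU P (-1) (Suc n))\<^sup>2 - P * lucasU P (-1) (Suc n) * lucasU P (-1) n - (lucasU P (-1) n)\<^sup>2 = (-1) ^ n"
proof (induction n)
  case (Suc n)
  then show ?case by (simp add: algebra_simps power2_eq_square)
qed simp

lemma lucasU_companion:
  "(2 * lucasU P (-1) (Suc n) - P * lucasU P (-1) n)\<^sup>2 = (P\<^sup>2 + 4) * (lucasU P (-1) n)\<^sup>2 + 4 * (-1) ^ n"
  unfolding lucasU_Cassini[of P n, symmetric] by (simp add: algebra_simps power2_eq_square)

text \<open>The square of a root of X^2 - PX - 1 has norm 1 and trace P^2 + 2, so the left side is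
  the companion of \<open>lucasU P (-1)\<close> at the doubled index.\<close>

lemma lucasV_eq_lucasU:
  "lucasV (P\<^sup>2 + 2) n = (P\<^sup>2 + 4) * (lucasU P (-1) n)\<^sup>2 + 2 * (-1) ^ n"
proof (induction "P\<^sup>2 + 2" n rule: lucasV.induct)
  case (3 n)
  let ?u = "lucasU P (-1)"
  have "lucasV (P\<^sup>2 + 2) (Suc (Suc n)) = (P\<^sup>2 + 2) * ((P\<^sup>2 + 4) * (?u (Suc n))\<^sup>2 - 2 * (-1) ^ n)
          - ((P\<^sup>2 + 4) * (?u n)\<^sup>2 + 2 * (-1) ^ n)"
    using 3 by simp
  also have "\<dots> = (P\<^sup>2 + 4) * (P * ?u (Suc n) + ?u n)\<^sup>2 + 2 * (-1) ^ n"
    unfolding lucasU_Cassini[of P n, symmetric] by (simp add: algebra_simps power2_eq_square)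
  finally show ?case by simp
qed simp_all

section \<open>Reduction of the sequences modulo an integer\<close>

definition lucas_step :: "int \<Rightarrow> int \<Rightarrow> int \<times> int \<Rightarrow> int \<times> int" where
  "lucas_step P M = (\<lambda>(u, v). (v, (P * v + u) mod M))"

lemma lucasU_mod:
  "(lucasU P (-1) n mod M, lucasU P (-1) (Suc n) mod M) = (lucas_step P M ^^ n) (0 mod M, 1 mod M)"
proof (induction n)
  case (Suc n)
  have "(lucas_step P M ^^ Suc n) (0 mod M, 1 mod M)
      = lucas_step P M (lucasU P (-1) n mod M, lucasU P (-1) (Suc n) mod M)"
    unfolding funpow.simps o_def Suc[symmetric] ..
  also have "\<dots> = (lucasU P (-1) (Suc n) mod M, lucasU P (-1) (Suc (Suc n)) mod M)"
    unfolding lucas_step_def by (auto intro!: mod_add_cong simp: mod_mult_right_eq)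
  finally show ?case ..
qed simp

text \<open>The first premise makes \<open>k\<close> a period of the reduced pairs, so a claim about
  all \<open>n\<close> is evaluated on finitely many residues; \<open>Q\<close> sees the residue of
  the index too.\<close>

lemma lucasU_mod_cases:
  assumes "(lucas_step P M ^^ k) (0 mod M, 1 mod M) = (0 mod M, 1 mod M)" "k > 0"
    and "\<forall>r\<in>set [0..<k]. Q r ((lucas_step P M ^^ r) (0 mod M, 1 mod M))"
  shows "Q (n mod k) (lucasU P (-1) n mod M, lucasU P (-1) (Suc n) mod M)"
proof -
  have "(lucasU P (-1) n mod M, lucasU P (-1) (Suc n) mod M)
      = (lucas_step P M ^^ (n mod k)) (0 mod M, 1 mod M)"
    using lucasU_mod[of P n M] funpow_mod_eq[OF assms(1), of n] by simp
  then show ?thesis using assms(2,3) by simp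
qed

lemma fib_companion_mod_21:
  assumes "(2 * lucasU 1 (-1) (Suc m) - lucasU 1 (-1) m) mod 21 \<in> {1, 20}"
  shows "m mod 16 \<in> {1, 15}"
proof -
  let ?Q = "\<lambda>r (u, v). (2 * v - u) mod 21 \<in> {1, 20} \<longrightarrow> r \<in> {1, 15}"
  have "?Q (m mod 16) (lucasU 1 (-1) m mod 21, lucasU 1 (-1) (Suc m) mod 21)"
    by (rule lucasU_mod_cases) (code_simp, simp, code_simp)
  moreover have "(2 * (lucasU 1 (-1) (Suc m) mod 21) - lucasU 1 (-1) m mod 21) mod 21
      = (2 * lucasU 1 (-1) (Suc m) - lucasU 1 (-1) m) mod 21"
    by (intro mod_diff_cong) (simp_all only: mod_mult_right_eq mod_mod_trivial)
  ultimately show ?thesis using assms by (simp only: prod.case simp_thms)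
qed

lemma pell_companion_mod_16_19:
  assumes "(lucasU 2 (-1) (Suc n) - lucasU 2 (-1) n) mod 16 \<in> {7, 9}"
    and "(lucasU 2 (-1) (Suc n) - lucasU 2 (-1) n) mod 19 \<in> {7, 12}"
    and "odd n"
  shows "n mod 40 \<in> {3, 37}"
proof -
  let ?Q = "\<lambda>r (u, v). (v - u) mod 19 \<in> {7, 12} \<longrightarrow> odd r \<longrightarrow> r \<in> {3, 17, 23, 37}"
  have "?Q (n mod 40) (lucasU 2 (-1) n mod 19, lucasU 2 (-1) (Suc n) mod 19)"
    by (rule lucasU_mod_cases) (code_simp, simp, code_simp)
  then have "odd (n mod 40) \<longrightarrow> n mod 40 \<in> {3, 17, 23, 37}"
    using assms(2) by (simp only: prod.case mod_diff_eq simp_thms)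
  moreover
  let ?Q = "\<lambda>r (u, v). (v - u) mod 16 \<in> {7, 9} \<longrightarrow> odd r \<longrightarrow> r \<in> {3, 5, 11, 13}"
  have "?Q (n mod 16) (lucasU 2 (-1) n mod 16, lucasU 2 (-1) (Suc n) mod 16)"
    by (rule lucasU_mod_cases) (code_simp, simp, code_simp)
  then have "odd (n mod 16) \<longrightarrow> n mod 16 \<in> {3, 5, 11, 13}"
    using assms(1) by (simp only: prod.case mod_diff_eq simp_thms)
  moreover have "odd (n mod 40)" "odd (n mod 16)" using assms(3) by presburger+
  \<comment> \<open>Modulo 8 the candidates 17 and 23 are 1 and 7, while those modulo 16 are all 3
    or 5.\<close>
  moreover have "n mod 40 mod 8 = n mod 16 mod 8" by (simp add: mod_mod_cancel)
  ultimately show ?thesis by auto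
qed

section \<open>The unit \<open>19 + 6\<surd>10\<close>\<close>

text \<open>Multiplication of x + y\<surd>10 by 19 + 6\<surd>10 = (3 + \<surd>10)^2.\<close>

definition unit10_step :: "int \<times> int \<Rightarrow> int \<times> int" where
  "unit10_step = (\<lambda>(x, y). (19 * x + 60 * y, 6 * x + 19 * y))"

lemma not_square_between:
  fixes n q x :: int
  assumes "n\<^sup>2 < q" "q < (n + 1)\<^sup>2" "0 \<le> n"
  shows "x\<^sup>2 \<noteq> q"
proof
  assume "x\<^sup>2 = q"
  then have "n\<^sup>2 < \<bar>x\<bar>\<^sup>2" "\<bar>x\<bar>\<^sup>2 < (n + 1)\<^sup>2" using assms by simp_all
  then have "n < \<bar>x\<bar>" "\<bar>x\<bar> < n + 1"
    using assms(3) power2_less_imp_less[of n "\<bar>x\<bar>"] power2_less_imp_less[of "\<bar>x\<bar>" "n + 1"] by auto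
  then show False by simp
qed

text \<open>Descent on \<open>y\<close>: multiplication by the inverse unit 19 - 6\<surd>10 yields a
  nonnegative solution with smaller \<open>y\<close>.\<close>

lemma pell10_pos_solution:
  fixes x y :: int
  assumes "x\<^sup>2 - 10 * y\<^sup>2 = 1" "x \<ge> 0" "y \<ge> 0"
  shows "\<exists>k. (x, y) = (unit10_step ^^ k) (1, 0)"
  using assms
proof (induction "nat y" arbitrary: x y rule: less_induct)
  case less
  show ?case
  proof (cases "y = 0")
    case True
    then have "(x, y) = (unit10_step ^^ 0) (1, 0)"
      using less.prems by (simp add: power2_eq_1_iff)
    then show ?thesis by blast
  next
    case False
    define x' y' where "x' = 19 * x - 60 * y" and "y' = 19 * y - 6 * x"
    have y: "y \<ge> 1" using False less.prems by simp
    have "3 * y < x"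
    proof (rule power2_less_imp_less)
      have "(3 * y)\<^sup>2 = 9 * y\<^sup>2" "0 \<le> y\<^sup>2" by simp_all
      then show "(3 * y)\<^sup>2 < x\<^sup>2" using less.prems(1) by linarith
    qed (use less.prems in simp)
    \<comment> \<open>Needed for (6x)^2 = 360y^2 + 36 \<le> (19y)^2. For smaller \<open>y\<close>
      the number 10y^2 + 1 lies strictly between consecutive squares.\<close>
    have "y \<ge> 6"
    proof (rule ccontr)
      assume "\<not> y \<ge> 6"
      then have "y \<in> {1, 2, 3, 4, 5}" using y by auto
      then have "x\<^sup>2 \<in> {11, 41, 91, 161, 251}" using less.prems(1) by auto
      then show False
        using not_square_between[of 3 11 x] not_square_between[of 6 41 x] not_square_between[of 9 91 x]
          not_square_between[of 12 161 x] not_square_between[of 15 251 x] by simp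
    qed
    then have "36 \<le> y * y" using mult_mono[of 6 y 6 y] by simp
    have "(6 * x)\<^sup>2 \<le> (19 * y)\<^sup>2"
      using less.prems(1) \<open>36 \<le> y * y\<close> by (simp add: power2_eq_square)
    then have "6 * x \<le> 19 * y" by (rule power2_le_imp_le) (use y in simp)
    then have y': "0 \<le> y'" "y' < y" using \<open>3 * y < x\<close> by (simp_all add: y'_def)
    have "(60 * y)\<^sup>2 \<le> (19 * x)\<^sup>2"
      using less.prems(1) \<open>36 \<le> y * y\<close> by (simp add: power2_eq_square)
    then have "60 * y \<le> 19 * x" by (rule power2_le_imp_le) (use less.prems(2) in simp)
    then have "0 \<le> x'" by (simp add: x'_def)
    moreover have "x'\<^sup>2 - 10 * y'\<^sup>2 = 1"
      using less.prems(1) by (simp add: x'_def y'_def power2_eq_square algebra_simps)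
    moreover have "nat y' < nat y" using y' by simp
    ultimately obtain k where "(x', y') = (unit10_step ^^ k) (1, 0)"
      using less.hyps[of y' x'] y'(1) by blast
    moreover have "unit10_step (x', y') = (x, y)"
      by (simp add: unit10_step_def x'_def y'_def)
    ultimately have "(x, y) = (unit10_step ^^ Suc k) (1, 0)" by simp
    then show ?thesis ..
  qed
qed

text \<open>The same descent, ending at 3 + \<surd>10, the solution with
  \<open>y = 1\<close>.\<close>

lemma pell10_neg_solution:
  fixes x y :: int
  assumes "x\<^sup>2 - 10 * y\<^sup>2 = -1" "x \<ge> 0" "y \<ge> 0"
  shows "\<exists>k. (x, y) = (unit10_step ^^ k) (3, 1)"
  using assms
proof (induction "nat y" arbitrary: x y rule: less_induct)
  case less
  have "y \<noteq> 0"
  proof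
    assume "y = 0"
    then have "x\<^sup>2 = -1" using less.prems by simp
    then show False using zero_le_power2[of x] by linarith
  qed
  show ?case
  proof (cases "y = 1")
    case True
    then have "x\<^sup>2 = 3\<^sup>2" using less.prems by simp
    then have "x = 3" using less.prems by (simp only: power2_eq_iff_nonneg)
    then have "(x, y) = (unit10_step ^^ 0) (3, 1)" using True by simp
    then show ?thesis by blast
  next
    case False
    define x' y' where "x' = 19 * x - 60 * y" and "y' = 19 * y - 6 * x"
    have y: "y \<ge> 2" using False \<open>y \<noteq> 0\<close> less.prems by simp
    have "3 * y < x"
    proof (rule power2_less_imp_less)
      have "4 \<le> y * y" using mult_mono[of 2 y 2 y] y by simp
      then show "(3 * y)\<^sup>2 < x\<^sup>2" using less.prems(1) by (simp add: power2_eq_square)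
    qed (use less.prems in simp)
    \<comment> \<open>Here the bound serves (60y)^2 \<le> (19x)^2, which amounts to 361 \<le>
      10y^2.\<close>
    have "y \<ge> 7"
    proof (rule ccontr)
      assume "\<not> y \<ge> 7"
      then have "y \<in> {2, 3, 4, 5, 6}" using y by auto
      then have "x\<^sup>2 \<in> {39, 89, 159, 249, 359}" using less.prems(1) by auto
      then show False
        using not_square_between[of 6 39 x] not_square_between[of 9 89 x] not_square_between[of 12 159 x]
          not_square_between[of 15 249 x] not_square_between[of 18 359 x] by simp
    qed
    then have "49 \<le> y * y" using mult_mono[of 7 y 7 y] by simp
    have "(6 * x)\<^sup>2 \<le> (19 * y)\<^sup>2"
      using less.prems(1) \<open>49 \<le> y * y\<close> by (simp add: power2_eq_square)
    then have "6 * x \<le> 19 * y" by (rule power2_le_imp_le) (use y in simp)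
    then have y': "0 \<le> y'" "y' < y" using \<open>3 * y < x\<close> by (simp_all add: y'_def)
    have "(60 * y)\<^sup>2 \<le> (19 * x)\<^sup>2"
      using less.prems(1) \<open>49 \<le> y * y\<close> by (simp add: power2_eq_square)
    then have "60 * y \<le> 19 * x" by (rule power2_le_imp_le) (use less.prems(2) in simp)
    then have "0 \<le> x'" by (simp add: x'_def)
    moreover have "x'\<^sup>2 - 10 * y'\<^sup>2 = -1"
      using less.prems(1) by (simp add: x'_def y'_def power2_eq_square algebra_simps)
    moreover have "nat y' < nat y" using y' by simp
    ultimately obtain k where "(x', y') = (unit10_step ^^ k) (3, 1)"
      using less.hyps[of y' x'] y'(1) by blast
    moreover have "unit10_step (x', y') = (x, y)"
      by (simp add: unit10_step_def x'_def y'_def)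
    ultimately have "(x, y) = (unit10_step ^^ Suc k) (3, 1)" by simp
    then show ?thesis ..
  qed
qed

section \<open>Divisors of the rational part of a solution\<close>

lemma lucasV_38_unit10:
  "(2 * fst ((unit10_step ^^ k) (1, 0)), 2 * fst ((unit10_step ^^ Suc k) (1, 0))) = (lucasV 38 k, lucasV 38 (Suc k))"
proof (induction k)
  case (Suc k)
  obtain x y where xy: "(unit10_step ^^ k) (1, 0) = (x, y)" by fastforce
  with Suc have "lucasV 38 k = 2 * x" "lucasV 38 (Suc k) = 2 * (19 * x + 60 * y)"
    by (simp_all add: unit10_step_def)
  then show ?case using xy by (simp add: unit10_step_def)
qed (simp add: unit10_step_def)

lemma lucasV_double_half:
  assumes "lucasV c b = 2 * v"
  shows "lucasV c (2 * b) = 2 * (2 * v\<^sup>2 - 1)"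
  using assms by (simp add: lucasV_double power_mult_distrib)

lemma mod_2sq_minus_1:
  fixes v r m :: int
  assumes "v mod m = r"
  shows "(2 * v\<^sup>2 - 1) mod m = (2 * r\<^sup>2 - 1) mod m"
  unfolding assms[symmetric] by (intro mod_diff_cong) (metis mod_mult_right_eq power_mod, simp)

text \<open>Doubling the exponent maps the rational part v to 2v^2 - 1. This map fixes 1 modulo 8
  and 5, 6 modulo 13 and 18 modulo 37, and the first value 721 has these residues.\<close>

lemma lucasV_38_power2:
  "\<exists>w. lucasV 38 (2 ^ Suc s) = 2 * (2 * w\<^sup>2 - 1) \<and> 2 * w\<^sup>2 - 1 > 0 \<and> (2 * w\<^sup>2 - 1) mod 8 = 1
    \<and> (2 * w\<^sup>2 - 1) mod 5 = 1 \<and> (2 * w\<^sup>2 - 1) mod 13 = 6 \<and> (2 * w\<^sup>2 - 1) mod 37 = 18"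
proof (induction s)
  case 0
  have "lucasV 38 (2 ^ Suc 0) = 2 * (2 * 19\<^sup>2 - 1)" by (simp add: numeral_2_eq_2)
  then show ?case by (intro exI[of _ 19]) simp
next
  case (Suc s)
  then obtain v where v: "lucasV 38 (2 ^ Suc s) = 2 * v" "v > 0" "v mod 8 = 1" "v mod 5 = 1" "v mod 13 = 6" "v mod 37 = 18"
    by blast
  have "v\<^sup>2 > 0" using v(2) by simp
  then have "2 * v\<^sup>2 - 1 > 0" by linarith
  moreover have "lucasV 38 (2 ^ Suc (Suc s)) = 2 * (2 * v\<^sup>2 - 1)"
    using lucasV_double_half[OF v(1)] by simp
  ultimately show ?case
    using mod_2sq_minus_1[OF v(3)] mod_2sq_minus_1[OF v(4)] mod_2sq_minus_1[OF v(5)] mod_2sq_minus_1[OF v(6)]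
    by (intro exI[of _ v]) simp
qed

lemma power2_times_odd:
  fixes n :: nat
  assumes "n \<noteq> 0"
  shows "\<exists>s g. n = 2 ^ s * g \<and> odd g"
  using assms
proof (induction n rule: less_induct)
  case (less n)
  show ?case
  proof (cases "even n")
    case True
    then obtain m where m: "n = 2 * m" by blast
    then obtain s g where "m = 2 ^ s * g \<and> odd g" using less.IH[of m] less.prems by auto
    with m show ?thesis by (intro exI[of _ "Suc s"] exI[of _ g]) simp
  next
    case False
    then show ?thesis by (intro exI[of _ 0] exI[of _ n]) simp
  qed
qed

text \<open>If \<open>x\<close> belongs to the exponent \<open>2 ^ s * g\<close> with odd
  \<open>g\<close>, then \<open>v\<close> is the rational part at \<open>2 ^ s\<close>. The value 19
  is the case \<open>s = 0\<close>, which precedes the fixed residues.\<close>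

lemma pell10_divisor:
  fixes x y :: int
  assumes "x\<^sup>2 - 10 * y\<^sup>2 = 1" "y \<noteq> 0"
  shows "\<exists>v. v dvd x \<and> v > 0 \<and> (v = 19 \<or> v mod 8 = 1 \<and> v mod 5 = 1 \<and> v mod 13 = 6 \<and> v mod 37 = 18
    \<and> (\<exists>w. v = 2 * w\<^sup>2 - 1))"
proof -
  obtain k where k: "(\<bar>x\<bar>, \<bar>y\<bar>) = (unit10_step ^^ k) (1, 0)"
    using pell10_pos_solution[of "\<bar>x\<bar>" "\<bar>y\<bar>"] assms(1) by auto
  have "k \<noteq> 0" using k assms(2) by (intro notI) simp
  then obtain s g where g: "k = 2 ^ s * g" "odd g"
    using power2_times_odd by blast
  have "2 * \<bar>x\<bar> = lucasV 38 k"
    using lucasV_38_unit10[of k] by (simp flip: k)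
  then have dvd: "lucasV 38 (2 ^ s) dvd 2 * \<bar>x\<bar>"
    using lucasV_dvd_odd_multiple[OF g(2), of 38 "2 ^ s"] g(1) by simp
  show ?thesis
  proof (cases s)
    case 0
    then have "2 * 19 dvd 2 * \<bar>x\<bar>" using dvd by simp
    then have "19 dvd x" by (subst (asm) dvd_mult_cancel_left) simp
    then show ?thesis by auto
  next
    case (Suc s')
    then obtain v where v: "lucasV 38 (2 ^ s) = 2 * v"
      "v > 0 \<and> v mod 8 = 1 \<and> v mod 5 = 1 \<and> v mod 13 = 6 \<and> v mod 37 = 18 \<and> (\<exists>w. v = 2 * w\<^sup>2 - 1)"
      using lucasV_38_power2[of s'] by blast
    then have "v dvd x" using dvd by simp
    then show ?thesis using v(2) by blast
  qed
qed

lemma jacobi_prime_star_eq: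
  assumes "prime q" "2 < q" "odd n" "e \<in> {-1, 0, 1}"
    and "a = (-1) ^ ((q - 1) div 2) * int q"
    and "(int n mod int q) ^ ((q - 1) div 2) mod int q = e mod int q"
  shows "jacobi a n = e"
  using jacobi_prime_star[OF assms(1-3)] Legendre_eqI[OF assms(1,2,4,6)] assms(5) by simp

section \<open>Indices that are not both odd\<close>

lemma jacobi_2_eq_1:
  assumes "int n = 2 * w\<^sup>2 - 1"
  shows "jacobi 2 n = 1"
proof (rule jacobi_eq_1_if_square)
  have "(2 * w)\<^sup>2 - 2 = 2 * int n" using assms by (simp add: power_mult_distrib)
  then show "int n dvd (2 * w)\<^sup>2 - 2" by simp
  have "odd (int n)" unfolding assms by simp
  then show "coprime 2 (int n)" by simp
qed

lemma nat_mod_8_eq_1: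
  assumes "int n mod 8 = 1"
  shows "odd n" "n mod 4 = 1"
proof -
  have "int (n mod 8) = int 1" using assms by (simp add: zmod_int)
  then have "n mod 8 = 1" by (simp only: of_nat_eq_iff)
  then have "n mod 8 mod 4 = 1" "odd (n mod 8)" by simp_all
  then show "odd n" "n mod 4 = 1" by (simp_all add: mod_mod_cancel dvd_mod_iff)
qed

text \<open>130 = 2 * 5 * 13, and of the symbols of -1, 2, 5, 13 only the last is -1, as 6 is a
  non-residue modulo 13.\<close>

lemma not_dvd_square_plus_130:
  fixes v x :: int
  assumes "v > 0" "v = 2 * w\<^sup>2 - 1" "v mod 8 = 1" "v mod 5 = 1" "v mod 13 = 6"
  shows "\<not> v dvd x\<^sup>2 + 130"
proof
  assume dvd: "v dvd x\<^sup>2 + 130"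
  define n where "n = nat v"
  have n: "int n = v" using assms(1) by (simp add: n_def)
  have odd: "odd n" and "n mod 4 = 1" using n assms(3) by (simp_all add: nat_mod_8_eq_1)
  have "jacobi (-1) n = 1" using jacobi_minus_1[OF odd] \<open>n mod 4 = 1\<close> by simp
  moreover have "jacobi 2 n = 1" using jacobi_2_eq_1[of n w] n assms(2) by simp
  moreover have "jacobi 5 n = 1"
    by (rule jacobi_prime_star_eq[of 5]) (use odd n assms in simp_all)
  moreover have "jacobi 13 n = -1"
    by (rule jacobi_prime_star_eq[of 13]) (use odd n assms in simp_all)
  ultimately have "jacobi (-1 * (2 * (5 * 13))) n = -1"
    by (simp only: jacobi_mult[OF odd])
  moreover have "jacobi (-130) n \<ge> 0"
    by (rule jacobi_nonneg_if_square[of n x]) (use dvd n in simp)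
  ultimately show False by simp
qed

text \<open>370 = 2 * 5 * 37, and 18 is a non-residue modulo 37.\<close>

lemma not_dvd_square_plus_370:
  fixes v x :: int
  assumes "v > 0" "v = 2 * w\<^sup>2 - 1" "v mod 8 = 1" "v mod 5 = 1" "v mod 37 = 18"
  shows "\<not> v dvd x\<^sup>2 + 370"
proof
  assume dvd: "v dvd x\<^sup>2 + 370"
  define n where "n = nat v"
  have n: "int n = v" using assms(1) by (simp add: n_def)
  have odd: "odd n" and "n mod 4 = 1" using n assms(3) by (simp_all add: nat_mod_8_eq_1)
  have "jacobi (-1) n = 1" using jacobi_minus_1[OF odd] \<open>n mod 4 = 1\<close> by simp
  moreover have "jacobi 2 n = 1" using jacobi_2_eq_1[of n w] n assms(2) by simp
  moreover have "jacobi 5 n = 1"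
    by (rule jacobi_prime_star_eq[of 5]) (use odd n assms in simp_all)
  moreover have "jacobi 37 n = -1"
    by (rule jacobi_prime_star_eq[of 37]) (use odd n assms in simp_all)
  ultimately have "jacobi (-1 * (2 * (5 * 37))) n = -1"
    by (simp only: jacobi_mult[OF odd])
  moreover have "jacobi (-370) n \<ge> 0"
    by (rule jacobi_nonneg_if_square[of n x]) (use dvd n in simp)
  ultimately show False by simp
qed

lemma jacobi_prime: "prime p \<Longrightarrow> jacobi a p = Legendre a (int p)"
  by (simp add: jacobi_def prime_factorization_prime)

text \<open>-130 and -370 are 3 and 10 modulo 19, both non-residues.\<close>

lemma not_dvd_19:
  fixes x :: int
  shows "\<not> 19 dvd x\<^sup>2 + 130" "\<not> 19 dvd x\<^sup>2 + 370"
proof -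
  have "jacobi a 19 = -1" if "a mod 19 \<in> {3, 10}" for a
    using that Legendre_eqI[of 19 "-1" a] by (auto simp: jacobi_prime)
  then have "jacobi (-130) 19 = -1" "jacobi (-370) 19 = -1" by simp_all
  then show "\<not> 19 dvd x\<^sup>2 + 130" "\<not> 19 dvd x\<^sup>2 + 370"
    using jacobi_nonneg_if_square[of 19 x "-130"] jacobi_nonneg_if_square[of 19 x "-370"] by auto
qed

lemma square_mod_parity:
  fixes t :: int
  shows "odd t \<Longrightarrow> t\<^sup>2 mod 8 = 1" "even t \<Longrightarrow> t\<^sup>2 mod 4 = 0"
proof -
  show "t\<^sup>2 mod 8 = 1" if "odd t"
  proof -
    from that obtain k where k: "t = 2 * k + 1" by (rule oddE)
    have "even (k * (k + 1))" by simp
    then obtain j where "k * (k + 1) = 2 * j" by blast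
    then have "t\<^sup>2 = 8 * j + 1" by (simp add: k power2_eq_square algebra_simps)
    then show ?thesis by simp
  qed
  show "t\<^sup>2 mod 4 = 0" if "even t"
    using that by (auto simp: power_mult_distrib)
qed

text \<open>Up to the sign of \<open>z\<close>, \<open>p + q\<surd>10\<close> is the quotient of \<open>2y + z\<surd>10\<close> by \<open>6 + \<surd>10\<close>, both of norm \<open>26\<close>.\<close>

lemma even_odd_solution:
  fixes x y z :: int
  assumes y: "y\<^sup>2 = 5 * x\<^sup>2 + 4" and z: "z\<^sup>2 = 2 * x\<^sup>2 - 1"
  shows "x\<^sup>2 = 1"
proof -
  \<comment> \<open>Eliminates the terms that 13 does not divide; the sign of \<open>z'\<close> is
    then chosen to make the quotient in \<int>[\<surd>10] integral.\<close>
  have "(y - 3 * z) * (y + 3 * z) = 13 * (1 - x\<^sup>2)"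
    using y z by (simp add: algebra_simps power2_eq_square)
  then have "13 dvd (y - 3 * z) * (y + 3 * z)" by simp
  then have "13 dvd y - 3 * z \<or> 13 dvd y + 3 * z"
    by (subst (asm) prime_dvd_mult_iff) simp_all
  then obtain z' where z': "z'\<^sup>2 = z\<^sup>2" "13 dvd 3 * z' - y"
  proof
    assume "13 dvd y - 3 * z"
    then show ?thesis using that[of z] by (simp add: dvd_diff_commute)
  next
    assume "13 dvd y + 3 * z"
    then have "13 dvd 3 * (- z) - y" by presburger
    then show ?thesis using that[of "- z"] by simp
  qed
  then obtain q where q: "3 * z' - y = 13 * q" by blast
  define p where "p = z' - 6 * q"
  have z'_eq: "z' = p + 6 * q" and y_eq: "y = 3 * p + 5 * q" using q by (simp_all add: p_def)
  have eqs: "(3 * p + 5 * q)\<^sup>2 = 5 * x\<^sup>2 + 4" "(p + 6 * q)\<^sup>2 = 2 * x\<^sup>2 - 1"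
    using y z z'(1) z'_eq y_eq by simp_all
  have pell: "p\<^sup>2 - 10 * q\<^sup>2 = 1" and x2: "x\<^sup>2 = p\<^sup>2 + 6 * p * q + 13 * q\<^sup>2"
    using eqs by (simp_all add: power2_sum power_mult_distrib algebra_simps)
  show ?thesis
  proof (cases "q = 0")
    case True
    then show ?thesis using pell x2 by simp
  next
    case False
    obtain v w where v: "v dvd p" "v > 0" "v = 19 \<or> v mod 8 = 1 \<and> v mod 5 = 1 \<and> v mod 13 = 6 \<and> v = 2 * w\<^sup>2 - 1"
      using pell10_divisor[OF pell False] by metis
    \<comment> \<open>Modulo \<open>p\<close> the two relations read x^2 = 13q^2 and 10q^2 = -1, so
      100x^2 = -130.\<close>
    have "(10 * x)\<^sup>2 + 130 = 10 * (p * (23 * p + 60 * q))"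
      using pell unfolding power_mult_distrib x2 by (simp add: algebra_simps power2_eq_square)
    then have "v dvd (10 * x)\<^sup>2 + 130" using v(1) by simp
    then show ?thesis using v not_dvd_19(1) not_dvd_square_plus_130 by blast
  qed
qed

text \<open>Up to the sign of \<open>y\<close>, \<open>p - q\<surd>10\<close> is the quotient of \<open>2y + z\<surd>10\<close> by \<open>-8 + 3\<surd>10\<close>, both of norm \<open>-26\<close>.\<close>

lemma odd_even_solution:
  fixes x y z :: int
  assumes y: "y\<^sup>2 = 5 * x\<^sup>2 - 4" and z: "z\<^sup>2 = 2 * x\<^sup>2 + 1"
  shows "x\<^sup>2 = 4"
proof -
  have "even x"
  proof (rule ccontr)
    assume "odd x"
    then have "x\<^sup>2 mod 8 = 1" by (rule square_mod_parity)
    then have "z\<^sup>2 mod 8 = 3" using z by presburger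
    then show False using square_mod_parity[of z] by (cases "even z"; presburger)
  qed
  then have "x\<^sup>2 mod 4 = 0" by (rule square_mod_parity)
  then have "y\<^sup>2 mod 8 \<noteq> 1" using y by presburger
  then have "even y" using square_mod_parity by blast
  obtain x1 y1 where xy: "x = 2 * x1" "y = 2 * y1" using \<open>even x\<close> \<open>even y\<close> by blast
  have e1: "y1\<^sup>2 = 5 * x1\<^sup>2 - 1" and e2: "z\<^sup>2 = 8 * x1\<^sup>2 + 1"
    using y z by (simp_all add: xy power_mult_distrib)
  have "even y1"
  proof (rule ccontr)
    assume "odd y1"
    then have "y1\<^sup>2 mod 8 = 1" by (rule square_mod_parity)
    then have "x1\<^sup>2 mod 8 = 2" using e1 by presburger
    then show False using square_mod_parity[of x1] by (cases "even x1"; presburger)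
  qed
  then obtain y2 where y2: "y1 = 2 * y2" by blast
  have "(z - 5 * y1) * (z + 5 * y1) = 13 * (2 - 9 * x1\<^sup>2)"
    using e1 e2 by (simp add: algebra_simps power2_eq_square)
  then have "13 dvd (z - 5 * y1) * (z + 5 * y1)" by simp
  then have "13 dvd z - 5 * y1 \<or> 13 dvd z + 5 * y1"
    by (subst (asm) prime_dvd_mult_iff) simp_all
  then obtain u where u: "u\<^sup>2 = y2\<^sup>2" "13 dvd z - 10 * u"
    using that[of y2] that[of "- y2"] by (auto simp: y2)
  then obtain r where r: "z = 10 * u + 13 * r" by (metis add.commute diff_add_cancel dvdE)
  \<comment> \<open>Up to the sign of \<open>y\<close>, 2y + z\<surd>10 = 8u + (10u + 13r)\<surd>10.
    Times -8 - 3\<surd>10 and divided by -26 this is (14u + 15r) + 4(u + r)\<surd>10.\<close>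
  define p q where "p = 14 * u + 15 * r" and "q = - 4 * (u + r)"
  have eqs: "4 * u\<^sup>2 = 5 * x1\<^sup>2 - 1" "(10 * u + 13 * r)\<^sup>2 = 8 * x1\<^sup>2 + 1"
    using e1 e2 r u(1) y2 by (simp_all add: power_mult_distrib)
  have pell: "p\<^sup>2 - 10 * q\<^sup>2 = 1" and x2: "4 * x1\<^sup>2 = 4 * p\<^sup>2 + 24 * p * q + 37 * q\<^sup>2"
    using eqs by (simp_all add: p_def q_def power2_sum power2_diff power_mult_distrib algebra_simps power2_eq_square)
  show ?thesis
  proof (cases "q = 0")
    case True
    then show ?thesis using pell x2 xy by simp
  next
    case False
    obtain v w where v: "v dvd p" "v > 0" "v = 19 \<or> v mod 8 = 1 \<and> v mod 5 = 1 \<and> v mod 37 = 18 \<and> v = 2 * w\<^sup>2 - 1"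
      using pell10_divisor[OF pell False] by metis
    \<comment> \<open>Modulo \<open>p\<close>, 4x1^2 = 37q^2 and 10q^2 = -1, so 400x1^2 =
      -370.\<close>
    have "(20 * x1)\<^sup>2 + 370 = 100 * (4 * x1\<^sup>2) + 370" by (simp add: power_mult_distrib)
    also have "\<dots> = 10 * (p * (77 * p + 240 * q))"
      using pell unfolding x2 by (simp add: algebra_simps power2_eq_square)
    finally have "v dvd (20 * x1)\<^sup>2 + 370" using v(1) by simp
    then show ?thesis using v not_dvd_19(2) not_dvd_square_plus_370 by blast
  qed
qed

section \<open>Both indices even\<close>

lemma coprime_mult_eq_power:
  fixes a b c :: nat
  assumes "coprime a b" "a * b = c ^ n" "n > 0" "c > 0"
  shows "\<exists>u v. a = u ^ n \<and> b = v ^ n \<and> c = u * v"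
proof -
  have "a > 0" "b > 0" using assms(2,4) by (metis mult_eq_0_iff neq0_conv power_not_zero)+
  then have "is_nth_power n a" "is_nth_power n b"
    using is_nth_power_mult_coprime_natD[of a b n] assms by (auto simp: is_nth_power_def)
  then obtain u v where uv: "a = u ^ n" "b = v ^ n" by (auto elim!: is_nth_powerE)
  then have "(u * v) ^ n = c ^ n" using assms(2) by (simp add: power_mult_distrib)
  then have "c = u * v" using assms(3) by (simp add: power_eq_iff_eq_base)
  with uv show ?thesis by blast
qed

lemma fourth_power_mod_5: "(c::nat) ^ 4 mod 5 \<in> {0, 1}"
proof -
  have "c mod 5 \<in> {0, 1, 2, 3, 4}" unfolding insert_iff empty_iff by presburger
  then have "(c mod 5) ^ 4 mod 5 \<in> {0, 1}" by auto
  then show ?thesis by (simp only: power_mod)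
qed

lemma fourth_power_mod_5_impossible:
  fixes c d :: nat
  shows "40 * c ^ 4 \<noteq> d ^ 4 + 1" "8 * c ^ 4 \<noteq> 5 * d ^ 4 + 1" "5 * c ^ 4 \<noteq> 8 * d ^ 4 + 1" "5 * c ^ 4 \<noteq> 2 * d ^ 4 + 1"
proof -
  have *: "t ^ 4 mod 5 = 0 \<or> t ^ 4 mod 5 = 1" for t :: nat using fourth_power_mod_5[of t] by blast
  show "40 * c ^ 4 \<noteq> d ^ 4 + 1" using *[of d] by presburger
  show "8 * c ^ 4 \<noteq> 5 * d ^ 4 + 1" using *[of c] by presburger
  have "\<not> 5 dvd 8 * q + 1 \<and> \<not> 5 dvd 2 * q + 1" if "q mod 5 = 0 \<or> q mod 5 = 1" for q :: nat
    using that by presburger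
  then show "5 * c ^ 4 \<noteq> 8 * d ^ 4 + 1" "5 * c ^ 4 \<noteq> 2 * d ^ 4 + 1"
    using *[of d] by (metis dvd_triv_left)+
qed

text \<open>Each of 5 and 8 divides one of the coprime numbers \<open>e\<close> and
  \<open>e + 1\<close>, and the cofactors are fourth powers. Of the four distributions only
  \<open>40 dvd e\<close> survives modulo 5.\<close>

lemma split_consecutive_40:
  fixes a e :: nat
  assumes "e * (e + 1) = 40 * a ^ 4" "a > 0"
  shows "\<exists>c d. a = c * d \<and> d ^ 4 = 40 * c ^ 4 + 1"
proof -
  have cop: "coprime e (e + 1)" by simp
  have "5 dvd e * (e + 1)" using assms(1) by simp
  then have five: "5 dvd e \<or> 5 dvd e + 1" by (subst (asm) prime_dvd_mult_iff) simp_all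
  have 8: "8 dvd e * (e + 1)" unfolding assms(1) by presburger
  have cop8: "coprime 8 t" if "odd t" for t :: nat
  proof -
    have "coprime (2 ^ 3) t" using that by (simp only: coprime_power_left_iff) simp
    then show ?thesis by simp
  qed
  have eight: "8 dvd e \<or> 8 dvd e + 1"
  proof (cases "even e")
    case True
    then have "coprime 8 (e + 1)" by (intro cop8) simp
    then show ?thesis using 8 by (simp only: coprime_dvd_mult_left_iff simp_thms)
  next
    case False
    then have "coprime 8 e" by (rule cop8)
    then show ?thesis using 8 by (simp only: coprime_dvd_mult_right_iff simp_thms)
  qed
  have "5 dvd t \<Longrightarrow> 8 dvd t \<Longrightarrow> 40 dvd t" for t :: nat by presburger
  with five eight consider "40 dvd e" | "40 dvd e + 1" | "5 dvd e" "8 dvd e + 1" | "8 dvd e" "5 dvd e + 1"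
    by blast
  then show ?thesis
  proof cases
    case 1
    then obtain f where f: "e = 40 * f" by blast
    have "coprime f (e + 1)" by (rule coprime_divisors[OF _ _ cop]) (simp_all add: f)
    moreover have "f * (e + 1) = a ^ 4" using assms(1) by (simp add: f)
    ultimately obtain c d where "f = c ^ 4" "e + 1 = d ^ 4" "a = c * d"
      using coprime_mult_eq_power assms(2) by (metis zero_less_numeral)
    then show ?thesis using f by metis
  next
    case 2
    then obtain f where f: "e + 1 = 40 * f" by blast
    have "coprime e f" by (rule coprime_divisors[OF _ _ cop]) (simp_all only: f dvd_refl dvd_triv_right)
    moreover have "e * f = a ^ 4" using assms(1) unfolding f by simp
    ultimately obtain c d where "e = d ^ 4" "f = c ^ 4"
      using coprime_mult_eq_power assms(2) by (metis zero_less_numeral)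
    then show ?thesis using f fourth_power_mod_5_impossible(1)[of c d] by simp
  next
    case 3
    then obtain f g where f: "e = 5 * f" "e + 1 = 8 * g" by (elim dvdE)
    have "coprime f g" by (rule coprime_divisors[OF _ _ cop]) (simp add: f(1), simp only: f(2) dvd_triv_right)
    moreover have "f * g = a ^ 4" using assms(1) unfolding f(2) unfolding f(1) by simp
    ultimately obtain c d where "f = c ^ 4" "g = d ^ 4"
      using coprime_mult_eq_power assms(2) by (metis zero_less_numeral)
    then show ?thesis using f fourth_power_mod_5_impossible(2)[of d c] by simp
  next
    case 4
    then obtain f g where f: "e = 8 * f" "e + 1 = 5 * g" by (elim dvdE)
    have "coprime f g" by (rule coprime_divisors[OF _ _ cop]) (simp add: f(1), simp only: f(2) dvd_triv_right)
    moreover have "f * g = a ^ 4" using assms(1) unfolding f(2) unfolding f(1) by simp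
    ultimately obtain c d where "f = c ^ 4" "g = d ^ 4"
      using coprime_mult_eq_power assms(2) by (metis zero_less_numeral)
    then show ?thesis using f fourth_power_mod_5_impossible(3)[of d c] by simp
  qed
qed

text \<open>Turns an equation for d^4 - 1 back into one for a product of consecutive numbers; here m
  = (d^2 - 1)/2.\<close>

lemma odd_fourth_power:
  fixes d :: nat
  assumes "odd d"
  shows "\<exists>m. even m \<and> d\<^sup>2 = 2 * m + 1 \<and> d ^ 4 = 4 * (m * (m + 1)) + 1"
proof -
  from assms obtain k where k: "d = 2 * k + 1" by (rule oddE)
  have d2: "d\<^sup>2 = 2 * (2 * (k * (k + 1))) + 1" by (simp add: k power2_eq_square algebra_simps)
  have "d ^ 4 = (d\<^sup>2)\<^sup>2" by (simp flip: power_mult)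
  also have "\<dots> = 4 * (2 * (k * (k + 1)) * (2 * (k * (k + 1)) + 1)) + 1"
    unfolding d2 by (simp add: power2_eq_square algebra_simps)
  finally show ?thesis using d2 by (intro exI[of _ "2 * (k * (k + 1))"]) simp
qed

text \<open>Together with \<open>split_consecutive_40\<close> this is one round of the descent \<open>a \<mapsto> c \<mapsto> h\<close>.\<close>

lemma descent_40:
  fixes c d :: nat
  assumes "d ^ 4 = 40 * c ^ 4 + 1" "c > 0"
  shows "\<exists>h m. m * (m + 1) = 40 * h ^ 4 \<and> 0 < h \<and> h < c"
proof -
  have "odd (d ^ 4)" using assms(1) by simp
  then have "odd d" by simp
  then obtain e where e: "even e" "d ^ 4 = 4 * (e * (e + 1)) + 1"
    using odd_fourth_power by blast
  then have ee: "e * (e + 1) = 10 * c ^ 4" using assms(1) by simp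
  have cop: "coprime e (e + 1)" by simp
  have "5 dvd e * (e + 1)" using ee by simp
  then have "5 dvd e \<or> 5 dvd e + 1" by (subst (asm) prime_dvd_mult_iff) simp_all
  then show ?thesis
  proof
    assume "5 dvd e"
    with \<open>even e\<close> have "10 dvd e" by presburger
    then obtain g where g: "e = 10 * g" by blast
    have "coprime g (e + 1)" by (rule coprime_divisors[OF _ _ cop]) (simp_all add: g)
    moreover have "g * (e + 1) = c ^ 4" using ee by (simp add: g)
    ultimately obtain f u where fu: "g = f ^ 4" "e + 1 = u ^ 4" "c = f * u"
      using coprime_mult_eq_power assms(2) by (metis zero_less_numeral)
    then have u: "u ^ 4 = 10 * f ^ 4 + 1" using g by simp
    then have "odd (u ^ 4)" by simp
    then have "odd u" by simp
    then obtain m where m: "even m" "u ^ 4 = 4 * (m * (m + 1)) + 1"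
      using odd_fourth_power by blast
    \<comment> \<open>The second passage to consecutive numbers leaves 5f^4/2; since
      \<open>f\<close> must be even, the factor 40 reappears.\<close>
    then have m': "2 * (m * (m + 1)) = 5 * f ^ 4" using u by simp
    then have "even (5 * f ^ 4)" by (metis dvd_triv_left)
    then have "even f" by simp
    then obtain h where h: "f = 2 * h" by blast
    then have "m * (m + 1) = 40 * h ^ 4" using m' by (simp add: power_mult_distrib)
    moreover have "0 < h" "h < c" using fu(3) h assms(2) by auto
    ultimately show ?thesis by blast
  next
    assume "5 dvd e + 1"
    then obtain g where g: "e + 1 = 5 * g" by blast
    obtain g' where g': "e = 2 * g'" using \<open>even e\<close> by blast
    have "coprime g' g" by (rule coprime_divisors[OF _ _ cop]) (simp add: g', simp only: g dvd_triv_right)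
    moreover have "g' * g = c ^ 4" using ee unfolding g unfolding g' by simp
    ultimately obtain u f where "g' = f ^ 4" "g = u ^ 4"
      using coprime_mult_eq_power assms(2) by (metis zero_less_numeral)
    then show ?thesis using g g' fourth_power_mod_5_impossible(4)[of u f] by simp
  qed
qed

lemma consecutive_product_40:
  fixes a e :: nat
  assumes "e * (e + 1) = 40 * a ^ 4"
  shows "a = 0"
  using assms
proof (induction a arbitrary: e rule: less_induct)
  case (less a)
  show ?case
  proof (rule ccontr)
    assume "a \<noteq> 0"
    then obtain c d where cd: "a = c * d" "d ^ 4 = 40 * c ^ 4 + 1"
      using split_consecutive_40 less.prems by blast
    with \<open>a \<noteq> 0\<close> have "c > 0" "c \<le> a" by auto
    then obtain h m where "m * (m + 1) = 40 * h ^ 4" "0 < h" "h < c"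
      using descent_40 cd(2) by blast
    then show False using less.IH[of h m] \<open>c \<le> a\<close> by simp
  qed
qed

lemma coprime_mult_eq_square_int:
  fixes a b c :: int
  assumes "coprime a b" "a * b = c\<^sup>2" "a > 0" "b > 0"
  shows "\<exists>u v. a = u\<^sup>2 \<and> b = v\<^sup>2"
proof -
  have "coprime (nat a) (nat b)" using assms by (simp add: coprime_int_iff[symmetric])
  moreover have "int (nat a * nat b) = int ((nat \<bar>c\<bar>)\<^sup>2)" using assms by simp
  then have "nat a * nat b = (nat \<bar>c\<bar>)\<^sup>2" by (simp only: of_nat_eq_iff)
  moreover have "nat \<bar>c\<bar> > 0" using assms by auto
  ultimately obtain u v where "nat a = u\<^sup>2" "nat b = v\<^sup>2"
    using coprime_mult_eq_power by (metis zero_less_numeral)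
  then have "a = (int u)\<^sup>2" "b = (int v)\<^sup>2" using assms(3,4) by (metis int_nat_eq of_nat_power order_less_imp_le)+
  then show ?thesis by blast
qed

text \<open>After division by 3 the coprime factors \<open>a\<close> and \<open>n\<close> have a
  square product, so both are squares, and the quadratic relation becomes the equation of the
  descent.\<close>

lemma no_factor_pair:
  fixes m n k :: int
  assumes "m * n = 3 * k\<^sup>2" "3 * m\<^sup>2 + 3 * n\<^sup>2 - 26 * (m * n) = 3" "m > 0" "n > 0" "3 dvd m"
  shows False
proof -
  from assms(5) obtain a where a: "m = 3 * a" by blast
  have rel: "9 * a\<^sup>2 + n\<^sup>2 - 26 * (a * n) = 1" using assms(2) by (simp add: a power_mult_distrib)
  have "coprime a n"
  proof (rule coprimeI)
    fix g assume "g dvd a" "g dvd n"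
    then have "g dvd 9 * a\<^sup>2 + n\<^sup>2 - 26 * (a * n)" by (simp add: power2_eq_square)
    then show "is_unit g" by (simp add: rel)
  qed
  moreover have "a * n = k\<^sup>2" using assms(1) by (simp add: a)
  moreover have "a > 0" using assms(3) a by simp
  ultimately obtain u v where uv: "a = u\<^sup>2" "n = v\<^sup>2"
    using coprime_mult_eq_square_int assms(4) by blast
  \<comment> \<open>Completing the square in \<open>rel\<close> gives (n - 13a)^2 = 160a^2 + 1 with
    a = u^2.\<close>
  define w where "w = nat \<bar>v\<^sup>2 - 13 * u\<^sup>2\<bar>"
  have "(v\<^sup>2 - 13 * u\<^sup>2)\<^sup>2 = 160 * u ^ 4 + 1"
    using rel unfolding uv by (simp add: power2_eq_square algebra_simps power4_eq_xxxx)
  then have "int (w\<^sup>2) = int (160 * nat \<bar>u\<bar> ^ 4 + 1)" by (simp add: w_def)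
  then have w: "w\<^sup>2 = 160 * nat \<bar>u\<bar> ^ 4 + 1" by (simp only: of_nat_eq_iff)
  then have "odd (w\<^sup>2)" by simp
  then have "odd w" by simp
  then obtain e where e: "w = 2 * e + 1" by (rule oddE)
  have "e * (e + 1) = 40 * nat \<bar>u\<bar> ^ 4" using w unfolding e by (simp add: power2_eq_square)
  then have "nat \<bar>u\<bar> = 0" by (rule consecutive_product_40)
  then show False using \<open>a > 0\<close> uv by simp
qed

text \<open>With x = 4k and y = 2y1, half the difference and half the sum of |z| and |y1| have
  product 3k^2. The resulting relation is symmetric, so either factor may be the one divisible by
  3.\<close>

lemma even_even_solution:
  fixes x y z :: int
  assumes y: "y\<^sup>2 = 5 * x\<^sup>2 + 4" and z: "z\<^sup>2 = 2 * x\<^sup>2 + 1"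
  shows "x = 0"
proof (rule ccontr)
  assume "x \<noteq> 0"
  have "even x"
  proof (rule ccontr)
    assume "odd x"
    then have "x\<^sup>2 mod 8 = 1" by (rule square_mod_parity)
    then have "z\<^sup>2 mod 8 = 3" using z by presburger
    then show False using square_mod_parity[of z] by (cases "even z"; presburger)
  qed
  then have "x\<^sup>2 mod 4 = 0" by (rule square_mod_parity)
  then have "y\<^sup>2 mod 8 \<noteq> 1" using y by presburger
  then have "even y" using square_mod_parity by blast
  obtain x1 y1 where xy: "x = 2 * x1" "y = 2 * y1" using \<open>even x\<close> \<open>even y\<close> by blast
  have e1: "y1\<^sup>2 = 5 * x1\<^sup>2 + 1" and e2: "z\<^sup>2 = 8 * x1\<^sup>2 + 1"
    using y z by (simp_all add: xy power_mult_distrib)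
  have "even x1"
  proof (rule ccontr)
    assume "odd x1"
    then have "x1\<^sup>2 mod 8 = 1" by (rule square_mod_parity)
    then have "y1\<^sup>2 mod 8 = 6" using e1 by presburger
    then show False using square_mod_parity[of y1] by (cases "even y1"; presburger)
  qed
  then obtain k where k: "x1 = 2 * k" by blast
  have "odd (y1\<^sup>2)" "odd (z\<^sup>2)" unfolding e1 e2 k by (simp_all add: power_mult_distrib)
  then have "odd y1" "odd z" by simp_all
  then have "even (\<bar>z\<bar> - \<bar>y1\<bar>)" by simp
  then obtain m where m: "\<bar>z\<bar> - \<bar>y1\<bar> = 2 * m" by blast
  define n where "n = \<bar>y1\<bar> + m"
  have zn: "\<bar>z\<bar> = n + m" and yn: "\<bar>y1\<bar> = n - m" using m by (simp_all add: n_def)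
  have eqs: "(n - m)\<^sup>2 = 20 * k\<^sup>2 + 1" "(n + m)\<^sup>2 = 32 * k\<^sup>2 + 1"
    using e1 e2 unfolding zn[symmetric] yn[symmetric] k by (simp_all add: power_mult_distrib)
  have mn: "m * n = 3 * k\<^sup>2" and rel: "3 * m\<^sup>2 + 3 * n\<^sup>2 - 26 * (m * n) = 3"
    using eqs by (simp_all add: power2_sum power2_diff algebra_simps)
  have "k \<noteq> 0" using \<open>x \<noteq> 0\<close> xy k by simp
  then have "k\<^sup>2 > 0" by simp
  then have "m * n > 0" using mn by simp
  moreover have "n + m \<ge> 0" using zn by linarith
  ultimately have pos: "m > 0" "n > 0" by (auto simp: zero_less_mult_iff)
  have "3 dvd m * n" using mn by simp
  then have "3 dvd m \<or> 3 dvd n" by (subst (asm) prime_dvd_mult_iff) simp_all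
  then show False
    using no_factor_pair[of m n k] no_factor_pair[of n m k] mn rel pos by (auto simp: mult.commute add.commute)
qed

section \<open>Both indices odd\<close>

definition unit10_step_mod :: "int \<Rightarrow> int \<times> int \<Rightarrow> int \<times> int" where
  "unit10_step_mod M = (\<lambda>(x, y). ((19 * x + 60 * y) mod M, (6 * x + 19 * y) mod M))"

lemma unit10_step_mod:
  assumes "(x, y) = (unit10_step ^^ k) (a, b)"
  shows "(x mod M, y mod M) = (unit10_step_mod M ^^ k) (a mod M, b mod M)"
  using assms
proof (induction k arbitrary: x y)
  case (Suc k)
  obtain x' y' where xy': "(x', y') = (unit10_step ^^ k) (a, b)" by (metis surj_pair)
  then have "(x, y) = unit10_step (x', y')" using Suc.prems by simp
  then have xy: "x = 19 * x' + 60 * y'" "y = 6 * x' + 19 * y'"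
    by (simp_all add: unit10_step_def)
  have "(unit10_step_mod M ^^ Suc k) (a mod M, b mod M) = unit10_step_mod M (x' mod M, y' mod M)"
    by (simp add: Suc.IH[OF xy'])
  also have "\<dots> = (x mod M, y mod M)"
    unfolding unit10_step_mod_def xy by (auto intro!: mod_add_cong simp: mod_mult_right_eq)
  finally show ?case ..
qed simp

text \<open>The sequence has period \<open>8\<close> modulo \<open>6384 = 16 \<sdot> 3 \<sdot> 7 \<sdot> 19\<close>; the factors \<open>16\<close> and \<open>7\<close> detect that \<open>a\<^sup>2\<close> is a
  square, and \<open>21\<close>, \<open>16\<close>, \<open>19\<close> are the moduli that \<open>odd_odd_residues\<close> passes on.\<close>

lemma unit10_square_residue:
  fixes t a :: int
  assumes "(t, a\<^sup>2) = (unit10_step ^^ i) (3, 1)"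
  shows "a\<^sup>2 mod 6384 = 1 \<and> t mod 6384 \<in> {3, 6381}"
proof -
  let ?f = "unit10_step_mod 6384"
  have "(?f ^^ 8) (3, 1) = (3, 1)" by code_simp
  from funpow_mod_eq[OF this, of i] have "(t mod 6384, a\<^sup>2 mod 6384) = (?f ^^ (i mod 8)) (3, 1)"
    using unit10_step_mod[OF assms, of 6384] by simp
  moreover have "\<forall>r\<in>set [0..<8]. (\<lambda>(u, v). v mod 16 \<in> {0, 1, 4, 9} \<longrightarrow> v mod 7 \<in> {0, 1, 2, 4} \<longrightarrow> (u, v) \<in> {(3, 1), (6381, 1)})
      ((?f ^^ r) (3, 1))"
    by code_simp
  then have "(\<lambda>(u, v). v mod 16 \<in> {0, 1, 4, 9} \<longrightarrow> v mod 7 \<in> {0, 1, 2, 4} \<longrightarrow> (u, v) \<in> {(3, 1), (6381, 1)})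
      ((?f ^^ (i mod 8)) (3, 1))"
    by (rule bspec) simp
  ultimately have *: "a\<^sup>2 mod 6384 mod 16 \<in> {0, 1, 4, 9} \<longrightarrow> a\<^sup>2 mod 6384 mod 7 \<in> {0, 1, 2, 4}
      \<longrightarrow> (t mod 6384, a\<^sup>2 mod 6384) \<in> {(3, 1), (6381, 1)}"
    by (metis (no_types, lifting) case_prod_conv)
  have "a mod 16 \<in> {0, 1, 2, 3, 4, 5, 6, 7, 8, 9, 10, 11, 12, 13, 14, 15}"
    unfolding insert_iff empty_iff by presburger
  then have "(a mod 16)\<^sup>2 mod 16 \<in> {0, 1, 4, 9}" by auto
  then have "a\<^sup>2 mod 6384 mod 16 \<in> {0, 1, 4, 9}" by (simp only: power_mod) (simp add: mod_mod_cancel)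
  moreover have "a mod 7 \<in> {0, 1, 2, 3, 4, 5, 6}"
    unfolding insert_iff empty_iff by presburger
  then have "(a mod 7)\<^sup>2 mod 7 \<in> {0, 1, 2, 4}" by auto
  then have "a\<^sup>2 mod 6384 mod 7 \<in> {0, 1, 2, 4}" by (simp only: power_mod) (simp add: mod_mod_cancel)
  ultimately show ?thesis using * by auto
qed

lemma mod_linear_combination:
  fixes a b u v m :: int
  shows "(a * u + b * v) mod m = (a * (u mod m) + b * (v mod m)) mod m"
  by (intro mod_add_cong) (simp_all only: mod_mult_right_eq)

text \<open>One of 2Z - y and 2Z + y is divisible by 3. Its third part \<open>A\<close> and the
  other factor \<open>v\<close> are coprime with product x^2, so \<open>A\<close> is a square, and t
  + A\<surd>10 has norm -1. The class of \<open>t\<close>, 3 or -3, decides which alternative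
  holds.\<close>

lemma odd_odd_residues:
  fixes x y z :: int
  assumes y: "y\<^sup>2 = 5 * x\<^sup>2 - 4" and z: "z\<^sup>2 = 2 * x\<^sup>2 - 1"
  shows "y mod 21 \<in> {1, 20} \<or> z mod 16 \<in> {7, 9} \<and> z mod 19 \<in> {7, 12}"
proof -
  define Z where "Z = \<bar>z\<bar>"
  have Z: "Z\<^sup>2 = 2 * x\<^sup>2 - 1" using z by (simp add: Z_def)
  have "odd x"
  proof
    assume "even x"
    then have "x\<^sup>2 mod 4 = 0" by (rule square_mod_parity)
    then have "z\<^sup>2 mod 8 = 7" using z by presburger
    then show False using square_mod_parity[of z] by (cases "even z"; presburger)
  qed
  then have "x \<noteq> 0" by auto
  have "(2 * Z - y) * (2 * Z + y) = 3 * x\<^sup>2"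
    using y Z by (simp add: algebra_simps power2_eq_square)
  then have "3 dvd (2 * Z - y) * (2 * Z + y)" by simp
  then have "3 dvd 2 * Z - y \<or> 3 dvd 2 * Z + y"
    by (subst (asm) prime_dvd_mult_iff) simp_all
  then obtain y' where y': "y' = y \<or> y' = - y" "3 dvd 2 * Z + y'"
    by (metis diff_conv_add_uminus)
  then obtain A where A: "2 * Z + y' = 3 * A" by blast
  then have y'_eq: "y' = 3 * A - 2 * Z" by simp
  have "y'\<^sup>2 = 5 * x\<^sup>2 - 4" using y y'(1) by auto
  then have rel: "(3 * A - 2 * Z)\<^sup>2 = 5 * x\<^sup>2 - 4" unfolding y'_eq .
  \<comment> \<open>Equal to \<open>2 * Z - y'\<close>, the other factor.\<close>
  define v where "v = 4 * Z - 3 * A"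
  have Av: "A * v = x\<^sup>2" and rel2: "26 * (A * v) - 9 * A\<^sup>2 - v\<^sup>2 = 16"
    and pell: "(Z - 4 * A)\<^sup>2 - 10 * A\<^sup>2 = -1"
    using rel Z by (simp_all add: v_def power2_diff algebra_simps power2_eq_square)
  have "A * v > 0" using Av \<open>x \<noteq> 0\<close> by simp
  moreover have "v + 3 * A \<ge> 0" by (simp add: v_def Z_def)
  ultimately have pos: "A > 0" "v > 0" by (auto simp: zero_less_mult_iff)
  have "coprime A v"
  proof (rule coprimeI)
    fix g assume g: "g dvd A" "g dvd v"
    then have "g dvd 26 * (A * v) - 9 * A\<^sup>2 - v\<^sup>2" by (simp add: power2_eq_square)
    then have "g dvd 2 ^ 4" by (simp add: rel2)
    moreover have "odd (A * v)" using Av \<open>odd x\<close> by simp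
    then have "odd g" using g(1) by (auto dest: dvd_trans)
    then have "coprime g (2 ^ 4)" by (simp only: coprime_power_right_iff) simp
    ultimately show "is_unit g" by (simp add: coprime_absorb_left)
  qed
  then obtain a where a: "A = a\<^sup>2" using coprime_mult_eq_square_int Av pos by blast
  define t where "t = Z - 4 * A"
  have "\<bar>t\<bar>\<^sup>2 - 10 * A\<^sup>2 = -1" using pell by (simp add: t_def)
  then obtain i where "(\<bar>t\<bar>, a\<^sup>2) = (unit10_step ^^ i) (3, 1)"
    using pell10_neg_solution[of "\<bar>t\<bar>" A] pos a by auto
  from unit10_square_residue[OF this] have res: "A mod 6384 = 1" "\<bar>t\<bar> mod 6384 = 3 \<or> \<bar>t\<bar> mod 6384 = 6381"
    using a by auto
  moreover have "t = \<bar>t\<bar> \<or> t = - \<bar>t\<bar>" by linarith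
  ultimately have "t mod 6384 = 3 \<or> t mod 6384 = 6381"
    using zmod_zminus1_eq_if[of "\<bar>t\<bar>" 6384] by auto
  then show ?thesis
  proof
    assume t: "t mod 6384 = 3"
    have "t mod 6384 mod 16 = 3" "t mod 6384 mod 19 = 3" "A mod 6384 mod 16 = 1" "A mod 6384 mod 19 = 1"
      using t res(1) by simp_all
    then have "t mod 16 = 3" "t mod 19 = 3" "A mod 16 = 1" "A mod 19 = 1"
      by (simp_all add: mod_mod_cancel)
    moreover have "Z = 1 * t + 4 * A" by (simp add: t_def)
    ultimately have "Z mod 16 = 7" "Z mod 19 = 7"
      using mod_linear_combination[of 1 t 4 A] by simp_all
    moreover have "Z = z \<or> Z = - z" by (auto simp: Z_def)
    ultimately show ?thesis
      using zmod_zminus1_eq_if[of Z 16] zmod_zminus1_eq_if[of Z 19] by auto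
  next
    assume t: "t mod 6384 = 6381"
    have "t mod 6384 mod 21 = 18" "A mod 6384 mod 21 = 1" using t res(1) by simp_all
    then have "t mod 21 = 18" "A mod 21 = 1" by (simp_all add: mod_mod_cancel)
    \<comment> \<open>With A = 1 and t = -3 modulo 21 this is -5 + 6 = 1.\<close>
    moreover have "y' = (- 5) * A + (- 2) * t" by (simp add: y'_eq t_def)
    ultimately have "y' mod 21 = 1"
      using mod_linear_combination[of "- 5" A "- 2" t 21] by simp
    moreover have "y = y' \<or> y = - y'" using y'(1) by auto
    ultimately show ?thesis using zmod_zminus1_eq_if[of y' 21] by auto
  qed
qed

section \<open>Cohn's index argument in the remaining classes\<close>

text \<open>Doubling the index maps v to v^2 - 2, which fixes 3 modulo 4, 2 modulo 5 and 2 modulo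
  7.\<close>

lemma lucasV_3_power2:
  "lucasV 3 (8 * 2 ^ r) > 1 \<and> lucasV 3 (8 * 2 ^ r) mod 4 = 3 \<and> lucasV 3 (8 * 2 ^ r) mod 5 = 2 \<and> lucasV 3 (8 * 2 ^ r) mod 7 = 2"
proof (induction r)
  case 0
  have "lucasV 3 8 = 2207" by (simp add: eval_nat_numeral)
  then show ?case by simp
next
  case (Suc r)
  let ?v = "lucasV 3 (8 * 2 ^ r)"
  have eq: "lucasV 3 (8 * 2 ^ Suc r) = ?v\<^sup>2 - 2"
    using lucasV_double[of 3 "8 * 2 ^ r"] by (simp add: mult.left_commute)
  have "(?v\<^sup>2 - 2) mod m = ((?v mod m)\<^sup>2 - 2) mod m" for m
    by (intro mod_diff_cong) (simp_all add: power_mod)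
  moreover have "2 * 2 \<le> ?v * ?v" using Suc by (intro mult_mono) auto
  ultimately show ?case using Suc unfolding eq by (simp add: power2_eq_square)
qed

text \<open>For m = 16j \<plusminus> 1 with \<open>j \<noteq> 0\<close>, the modulus is the term at
  \<open>b = 8 * 2 ^ r\<close>, \<open>2 ^ r\<close> being the exact power of 2 in \<open>j\<close>.
  It would make -35 a square, but the symbols of 5 and -7 are -1 and 1.\<close>

lemma fib_index_mod_16:
  fixes z :: int
  assumes "z\<^sup>2 = 2 * (lucasU 1 (-1) m)\<^sup>2 - 1" "m mod 16 \<in> {1, 15}"
  shows "m = 1"
proof (rule ccontr)
  assume "m \<noteq> 1"
  let ?x = "lucasU 1 (-1) m"
  obtain j where j: "j \<noteq> 0" "m = 16 * j + 1 \<or> m = 16 * j - 1"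
  proof -
    have "m mod 16 = 1 \<or> m mod 16 = 15" using assms(2) by blast
    then obtain q where "m = 16 * q + 1 \<or> m = 16 * q + 15"
      by (metis mult_div_mod_eq)
    then show ?thesis using that[of q] that[of "Suc q"] \<open>m \<noteq> 1\<close> by (cases "q = 0") auto
  qed
  obtain r g where g: "j = 2 ^ r * g" "odd g" using power2_times_odd j(1) by blast
  let ?b = "8 * 2 ^ r :: nat"
  have "1 \<le> ?b * g" using g j(1) by (simp add: Suc_le_eq)
  moreover have "16 * j = 2 * ?b * g" using g(1) by simp
  ultimately have "lucasV 3 ?b dvd lucasV 3 m + lucasV 3 1"
    using lucasV_dvd_shift(1)[OF g(2), where c = 3 and b = ?b and a = 1]
      lucasV_dvd_shift(2)[OF g(2), where c = 3 and b = ?b and a = 1] j(2) by metis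
  moreover have "m mod 16 mod 2 = 1" using assms(2) by auto
  then have "odd m" by (simp add: mod_mod_cancel odd_iff_mod_2_eq_one)
  then have "lucasV 3 m + lucasV 3 1 = 5 * ?x\<^sup>2 + 1"
    using lucasV_eq_lucasU[of 1 m] by simp
  ultimately have "lucasV 3 ?b dvd 10 * (5 * ?x\<^sup>2 + 1)" by (simp only: dvd_mult)
  also have "10 * (5 * ?x\<^sup>2 + 1) = (5 * z)\<^sup>2 - (-35)" using assms(1) by (simp add: power_mult_distrib)
  finally have dvd: "lucasV 3 ?b dvd (5 * z)\<^sup>2 - (-35)" .
  define n where "n = nat (lucasV 3 ?b)"
  have n: "int n = lucasV 3 ?b" using lucasV_3_power2[of r] by (simp add: n_def)
  have res: "int n mod 4 = 3" "int n mod 5 = 2" "int n mod 7 = 2" unfolding n using lucasV_3_power2[of r] by blast+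
  have odd: "odd n" using res(1) by presburger
  have "jacobi 5 n = -1"
    by (rule jacobi_prime_star_eq[of 5]) (use odd res in simp_all)
  moreover have "jacobi (-7) n = 1"
    by (rule jacobi_prime_star_eq[of 7]) (use odd res in simp_all)
  ultimately have "jacobi (5 * (-7)) n = -1"
    by (simp only: jacobi_mult[OF odd])
  moreover have "jacobi (-35) n \<ge> 0"
    by (rule jacobi_nonneg_if_square[of n "5 * z"]) (use dvd n in simp)
  ultimately show False by simp
qed

text \<open>In every pair modulo \<open>23\<close> one entry is a non-residue, which is why two starting points \<open>4\<close> and \<open>20\<close>
  are followed.\<close>

lemma lucasV_6_power2:
  "\<exists>u w. lucasV 6 (4 * 2 ^ r) = 2 * (2 * u\<^sup>2 - 1) \<and> lucasV 6 (20 * 2 ^ r) = 2 * (2 * w\<^sup>2 - 1)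
    \<and> 2 * u\<^sup>2 - 1 > 0 \<and> 2 * w\<^sup>2 - 1 > 0 \<and> (2 * u\<^sup>2 - 1) mod 8 = 1 \<and> (2 * w\<^sup>2 - 1) mod 8 = 1
    \<and> (2 * u\<^sup>2 - 1) mod 11 = 5 \<and> (2 * w\<^sup>2 - 1) mod 11 = 5
    \<and> ((2 * u\<^sup>2 - 1) mod 23, (2 * w\<^sup>2 - 1) mod 23) \<in> {(2, 17), (7, 2), (5, 7), (3, 5), (17, 3)}"
proof (induction r)
  case 0
  have "lucasV 6 4 = 2 * (2 * 17\<^sup>2 - 1)" "lucasV 6 5 = 6726" by (simp_all add: eval_nat_numeral)
  moreover have "lucasV 6 20 = 2 * (2 * 22619537\<^sup>2 - 1)"
    using lucasV_double[of 6 10] lucasV_double[of 6 5] \<open>lucasV 6 5 = 6726\<close> by simp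
  \<comment> \<open>The witnesses are half the terms at the half indices 2 and 10; 22619537 =
    (6726^2 - 2)/2.\<close>
  ultimately show ?case by - (rule exI[of _ 17], rule exI[of _ 22619537], simp)
next
  case (Suc r)
  then obtain u w where u: "lucasV 6 (4 * 2 ^ r) = 2 * u" "u > 0" "u mod 8 = 1" "u mod 11 = 5"
    and w: "lucasV 6 (20 * 2 ^ r) = 2 * w" "w > 0" "w mod 8 = 1" "w mod 11 = 5"
    and uw: "(u mod 23, w mod 23) \<in> {(2, 17), (7, 2), (5, 7), (3, 5), (17, 3)}"
    by blast
  have "u\<^sup>2 > 0" "w\<^sup>2 > 0" using u(2) w(2) by simp_all
  then have "2 * u\<^sup>2 - 1 > 0" "2 * w\<^sup>2 - 1 > 0" by linarith+
  moreover have "lucasV 6 (4 * 2 ^ Suc r) = 2 * (2 * u\<^sup>2 - 1)" "lucasV 6 (20 * 2 ^ Suc r) = 2 * (2 * w\<^sup>2 - 1)"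
    using lucasV_double_half[OF u(1)] lucasV_double_half[OF w(1)] by (simp_all add: mult.left_commute)
  moreover have "(2 * u\<^sup>2 - 1) mod 8 = 1" "(2 * w\<^sup>2 - 1) mod 8 = 1"
    "(2 * u\<^sup>2 - 1) mod 11 = 5" "(2 * w\<^sup>2 - 1) mod 11 = 5"
    using mod_2sq_minus_1[OF u(3)] mod_2sq_minus_1[OF u(4)] mod_2sq_minus_1[OF w(3)] mod_2sq_minus_1[OF w(4)]
    by simp_all
  moreover have "((2 * u\<^sup>2 - 1) mod 23, (2 * w\<^sup>2 - 1) mod 23) \<in> {(2, 17), (7, 2), (5, 7), (3, 5), (17, 3)}"
  proof -
    \<comment> \<open>One cycle of length five under v -> 2v^2 - 1, each second entry being the
      predecessor of the first.\<close>
    let ?S = "{(2, 17), (7, 2), (5, 7), (3, 5), (17, 3)} :: (int \<times> int) set"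
    have "\<forall>p\<in>?S. ((2 * (fst p)\<^sup>2 - 1) mod 23, (2 * (snd p)\<^sup>2 - 1) mod 23) \<in> ?S" by simp
    from bspec[OF this uw] show ?thesis
      unfolding mod_2sq_minus_1[OF refl, of u 23] mod_2sq_minus_1[OF refl, of w 23] fst_conv snd_conv .
  qed
  ultimately show ?case by blast
qed

text \<open>506 = 2 * 11 * 23, where reciprocity applies to -11 and -23; 5 is a square modulo 11,
  while 5, 7, 17 are non-residues modulo 23.\<close>

lemma not_dvd_square_plus_506:
  fixes v x :: int
  assumes "v > 0" "v = 2 * w\<^sup>2 - 1" "v mod 8 = 1" "v mod 11 = 5" "v mod 23 \<in> {5, 7, 17}"
  shows "\<not> v dvd x\<^sup>2 + 506"
proof
  assume dvd: "v dvd x\<^sup>2 + 506"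
  define n where "n = nat v"
  have n: "int n = v" using assms(1) by (simp add: n_def)
  have odd: "odd n" and "n mod 4 = 1" using n assms(3) by (simp_all add: nat_mod_8_eq_1)
  have "jacobi (-1) n = 1" using jacobi_minus_1[OF odd] \<open>n mod 4 = 1\<close> by simp
  moreover have "jacobi 2 n = 1" using jacobi_2_eq_1[of n w] n assms(2) by simp
  moreover have "jacobi (-11) n = 1"
    by (rule jacobi_prime_star_eq[of 11]) (simp_all add: odd n assms(4))
  moreover have "jacobi (-23) n = -1"
    by (rule jacobi_prime_star_eq[of 23]) (use assms(5) in \<open>auto simp: odd n\<close>)
  ultimately have "jacobi (-1 * (2 * (-11 * -23))) n = -1"
    by (simp only: jacobi_mult[OF odd])
  moreover have "jacobi (-506) n \<ge> 0"
    by (rule jacobi_nonneg_if_square[of n x]) (use dvd n in simp)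
  ultimately show False by simp
qed

text \<open>For n = 40j \<plusminus> 3 with \<open>j \<noteq> 0\<close>, 40j is an odd multiple of
  both \<open>2 * (4 * 2 ^ r)\<close> and \<open>2 * (20 * 2 ^ r)\<close>. Both moduli would make
  -506 a square, and one of them fails modulo 23.\<close>

lemma pell_index_mod_40:
  fixes y :: int
  assumes "y\<^sup>2 = 5 * (lucasU 2 (-1) n)\<^sup>2 - 4" "n mod 40 \<in> {3, 37}"
  shows "n = 3"
proof (rule ccontr)
  assume "n \<noteq> 3"
  let ?x = "lucasU 2 (-1) n"
  obtain j where j: "j \<noteq> 0" "n = 40 * j + 3 \<or> n = 40 * j - 3"
  proof -
    have "n mod 40 = 3 \<or> n mod 40 = 37" using assms(2) by blast
    then obtain q where "n = 40 * q + 3 \<or> n = 40 * q + 37"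
      by (metis mult_div_mod_eq)
    then show ?thesis using that[of q] that[of "Suc q"] \<open>n \<noteq> 3\<close> by (cases "q = 0") auto
  qed
  obtain r g where g: "j = 2 ^ r * g" "odd g" using power2_times_odd j(1) by blast
  have "n mod 40 mod 2 = 1" using assms(2) by auto
  then have "odd n" by (simp add: mod_mod_cancel odd_iff_mod_2_eq_one)
  have sum: "lucasV 6 n + lucasV 6 3 = 2 * (4 * ?x\<^sup>2 + 98)"
    using lucasV_eq_lucasU[of 2 n] \<open>odd n\<close> by (simp add: eval_nat_numeral)
  have dvd: "v dvd (2 * y)\<^sup>2 + 506"
    if b: "lucasV 6 b = 2 * v" "40 * j = 2 * b * g'" "odd g'" for b g' v
  proof -
    have "3 \<le> b * g'" using b(2) j(1) by simp
    then have "2 * v dvd lucasV 6 n + lucasV 6 3"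
      using lucasV_dvd_shift(1)[OF b(3), where c = 6 and b = b and a = 3]
        lucasV_dvd_shift(2)[OF b(3), where c = 6 and b = b and a = 3] j(2) b(1,2) by metis
    then have "v dvd 4 * ?x\<^sup>2 + 98" unfolding sum by (subst (asm) dvd_mult_cancel_left) simp
    then have "v dvd 5 * (4 * ?x\<^sup>2 + 98)" by (rule dvd_mult)
    also have "5 * (4 * ?x\<^sup>2 + 98) = (2 * y)\<^sup>2 + 506" using assms(1) by (simp add: power_mult_distrib)
    finally show ?thesis .
  qed
  obtain u w where
    uw: "lucasV 6 (4 * 2 ^ r) = 2 * (2 * u\<^sup>2 - 1)" "lucasV 6 (20 * 2 ^ r) = 2 * (2 * w\<^sup>2 - 1)"
      "2 * u\<^sup>2 - 1 > 0" "2 * w\<^sup>2 - 1 > 0" "(2 * u\<^sup>2 - 1) mod 8 = 1" "(2 * w\<^sup>2 - 1) mod 8 = 1"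
      "(2 * u\<^sup>2 - 1) mod 11 = 5" "(2 * w\<^sup>2 - 1) mod 11 = 5"
      "((2 * u\<^sup>2 - 1) mod 23, (2 * w\<^sup>2 - 1) mod 23) \<in> {(2, 17), (7, 2), (5, 7), (3, 5), (17, 3)}"
    using lucasV_6_power2[of r] by blast
  have "(2 * u\<^sup>2 - 1) dvd (2 * y)\<^sup>2 + 506"
    by (rule dvd[OF uw(1), of "5 * g"]) (use g in simp_all)
  then have "(2 * u\<^sup>2 - 1) mod 23 \<notin> {5, 7, 17}"
    using not_dvd_square_plus_506[OF uw(3) refl uw(5,7)] by blast
  moreover have "(2 * w\<^sup>2 - 1) dvd (2 * y)\<^sup>2 + 506"
    by (rule dvd[OF uw(2), of g]) (use g in simp_all)
  then have "(2 * w\<^sup>2 - 1) mod 23 \<notin> {5, 7, 17}"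
    using not_dvd_square_plus_506[OF uw(4) refl uw(6,8)] by blast
  ultimately show False using uw(9) by auto
qed

lemma fib_pell_common_value:
  assumes eq: "lucasU 1 (-1) m = lucasU 2 (-1) n"
  shows "lucasU 1 (-1) m \<in> {0, 1, 2, 5}"
proof -
  define x where "x = lucasU 1 (-1) m"
  define y where "y = 2 * lucasU 1 (-1) (Suc m) - lucasU 1 (-1) m"
  define z where "z = lucasU 2 (-1) (Suc n) - lucasU 2 (-1) n"
  have "lucasU 1 (-1) k \<ge> 0 \<and> lucasU 1 (-1) (Suc k) \<ge> 0" for k
    by (induction k) simp_all
  then have nonneg: "lucasU 1 (-1) k \<ge> 0" for k by blast
  have y: "y\<^sup>2 = 5 * x\<^sup>2 + 4 * (-1) ^ m"
    using lucasU_companion[of 1 m] by (simp add: y_def x_def)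
  \<comment> \<open>For P = 2 the companion is even, and \<open>z\<close> is half of it.\<close>
  have "(2 * z)\<^sup>2 = 8 * x\<^sup>2 + 4 * (-1) ^ n"
    using lucasU_companion[of 2 n] by (simp add: z_def x_def eq algebra_simps)
  then have z: "z\<^sup>2 = 2 * x\<^sup>2 + (-1) ^ n" by (simp add: power_mult_distrib)
  have "x \<in> {0, 1, 2, 5}"
  proof (cases "even m"; cases "even n")
    assume "even m" "even n"
    then show ?thesis using even_even_solution[of y x z] y z by simp
  next
    assume "even m" "odd n"
    then have "x\<^sup>2 = 1\<^sup>2" using even_odd_solution[of y x z] y z by simp
    then show ?thesis using nonneg[of m] power2_eq_iff_nonneg[of x 1] by (simp add: x_def)
  next
    assume "odd m" "even n"
    then have "x\<^sup>2 = 2\<^sup>2" using odd_even_solution[of y x z] y z by simp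
    then show ?thesis using nonneg[of m] power2_eq_iff_nonneg[of x 2] by (simp add: x_def)
  next
    assume "odd m" "odd n"
    then have y: "y\<^sup>2 = 5 * x\<^sup>2 - 4" and z: "z\<^sup>2 = 2 * x\<^sup>2 - 1" using y z by simp_all
    from odd_odd_residues[OF y z] show ?thesis
    proof
      assume "y mod 21 \<in> {1, 20}"
      then have "m mod 16 \<in> {1, 15}" unfolding y_def by (rule fib_companion_mod_21)
      then have "m = 1" by (rule fib_index_mod_16[OF z[unfolded x_def]])
      then show ?thesis by (simp add: x_def)
    next
      assume "z mod 16 \<in> {7, 9} \<and> z mod 19 \<in> {7, 12}"
      then have "n mod 40 \<in> {3, 37}"
        using pell_companion_mod_16_19[of n] \<open>odd n\<close> unfolding z_def by blast
      then have "n = 3" by (rule pell_index_mod_40[OF y[unfolded x_def eq]])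
      then show ?thesis by (simp add: x_def eq eval_nat_numeral)
    qed
  qed
  then show ?thesis by (simp add: x_def)
qed

theorem theorem9:
  shows "range (lucasU 1 (-1)) \<inter> range (lucasU 2 (-1)) = {0, 1, 2, 5}"
proof
  show "range (lucasU 1 (-1)) \<inter> range (lucasU 2 (-1)) \<subseteq> {0, 1, 2, 5}"
  proof
    fix x assume "x \<in> range (lucasU 1 (-1)) \<inter> range (lucasU 2 (-1))"
    then obtain m n where "x = lucasU 1 (-1) m" "lucasU 1 (-1) m = lucasU 2 (-1) n" by auto
    then show "x \<in> {0, 1, 2, 5}" using fib_pell_common_value by metis
  qed
  have "{0, 1, 2, 5} = lucasU 1 (-1) ` {0, 1, 3, 5}" "{0, 1, 2, 5} = lucasU 2 (-1) ` {0, 1, 2, 3}"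
    by (simp_all add: eval_nat_numeral)
  then show "{0, 1, 2, 5} \<subseteq> range (lucasU 1 (-1)) \<inter> range (lucasU 2 (-1))"
    by (metis Int_greatest image_mono subset_UNIV)
qed

end
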